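(* Let $(\mathfrak{K},\mu)$ be a normed category. Then $\sigma(\mathfrak{K},\mu)$, the normed category of Cauchy sequences in $(\mathfrak{K},\mu)$ with the norm $\overline{\mu}$, is Cauchy complete.
   Context: A norm on a category $\mathfrak{K}$ is a function $\mu$ from the arrows of $\mathfrak{K}$ to $[0,+\infty]$ such that: (N1) $\mu(\mathrm{id}_x)=0$ for every object $x$; (N2) $\mu(f\circ g)\le \mu(f)+\mu(g)$ whenever $f\circ g$ is defined; (N3) $\mu(g)\le \mu(f\circ g)+\mu(f)$ whenever $f\circ g$ is defined. A normed category is a pair $(\mathfrak{K},\mu)$ where $\mu$ is a norm on $\mathfrak{K}$. A sequence in a category is a covariant functor $\vec{x}$ from $\omega$ (the natural numbers, as a poset category) to the category; $x_n$ is its $n$th object and $x_n^m\colon x_n\to x_m$ ($n\le m$) its bonding arrow. In a normed category $(\mathfrak{K},\mu)$, a sequence $\vec{x}$ is Cauchy if for every $\varepsilon>0$ there is $n_0$ such that $\mu(x_m^n)<\varepsilon$ whenever $n_0<m\le n$. A sequence $\vec{x}$ is convergent if there exist an object $v$ and arrows $g_n\colon x_n\to v$ ($n\in\omega$) such that (C1) $(v,(g_n)_{n\in\omega})$ is the colimit of $\vec{x}$, i.e. $g_m\circ x_n^m=g_n$ for $n<m$, and for every pair $(v',(g'_n)_{n\in\omega})$ with the same property there is a unique arrow $h\colon v\to v'$ with $h\circ g_n=g'_n$ for all $n$; and (C2) $\lim_{n\to\infty}\mu(g_n)=0$. A normed category is Cauchy complete if every Cauchy sequence in it is convergent. The objects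 of $\sigma(\mathfrak{K},\mu)$ are all Cauchy sequences in $(\mathfrak{K},\mu)$. Its arrows from $\vec{x}$ to $\vec{y}$ are the transformations from $\vec{x}$ to $\vec{y}$: a transformation is a natural transformation from $\vec{x}$ to $\vec{y}\circ\varphi$, where $\varphi\colon\omega\to\omega$ is increasing (i.e. a self-functor on $\omega$); more precisely, it is a family of arrows $\vec{f}=(f_n)_{n\in\omega}$ with $f_n\colon x_n\to y_{\varphi(n)}$ for some increasing map $\varphi\colon\omega\to\omega$, satisfying $y_{\varphi(m)}^{\varphi(n)}\circ f_m=f_n\circ x_m^n$ for every $m<n<\omega$. Transformations are composed in the obvious way: $\vec{f}\colon\vec{x}\to\vec{y}$ (along $\varphi$) followed by $\vec{g}\colon\vec{y}\to\vec{z}$ (along $\psi$) is $(g_{\varphi(n)}\circ f_n)_{n\in\omega}$ (along $\psi\circ\varphi$). The norm on $\sigma(\mathfrak{K},\mu)$ is $\overline{\mu}(\vec{f})=\lim_{n\to\infty}\mu(f_n)$ (this limit exists for every transformation of Cauchy sequences).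
   Formalization: Arrows of σ(K,μ) are transformations along unbounded increasing φ, identified when, for each n, their n-th components agree after composing with bonding arrows of the target; without the identification completeness fails, and with bounded φ axiom (N2) fails. *)

theory Defs
  imports "HOL-Analysis.Analysis"
begin

section \<open>Categories\<close>

text \<open>
  \<open>Comp K f g\<close> is \<open>f \<circ> g\<close> (first \<open>g\<close>, then \<open>f\<close>). It is constrained only for composable arrows
  of \<open>K\<close>.
\<close>

record ('o, 'a) precategory =
  Obj :: "'o set"
  Arr :: "'a set"
  Dom :: "'a \<Rightarrow> 'o"
  Cod :: "'a \<Rightarrow> 'o"
  Ident :: "'o \<Rightarrow> 'a"
  Comp :: "'a \<Rightarrow> 'a \<Rightarrow> 'a"

definition Hom :: "('o, 'a) precategory \<Rightarrow> 'o \<Rightarrow> 'o \<Rightarrow> 'a set" where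
  "Hom K x y = {f \<in> Arr K. Dom K f = x \<and> Cod K f = y}"

locale category =
  fixes K :: "('o, 'a) precategory"
  assumes Dom_in_Obj: "f \<in> Arr K \<Longrightarrow> Dom K f \<in> Obj K"
    and Cod_in_Obj: "f \<in> Arr K \<Longrightarrow> Cod K f \<in> Obj K"
    and Ident_in_Hom: "x \<in> Obj K \<Longrightarrow> Ident K x \<in> Hom K x x"
    and Comp_in_Hom: "g \<in> Hom K x y \<Longrightarrow> f \<in> Hom K y z \<Longrightarrow> Comp K f g \<in> Hom K x z"
    and Comp_Ident_right: "f \<in> Hom K x y \<Longrightarrow> Comp K f (Ident K x) = f"
    and Comp_Ident_left: "f \<in> Hom K x y \<Longrightarrow> Comp K (Ident K y) f = f"
    and Comp_assoc:
      "h \<in> Hom K w x \<Longrightarrow> g \<in> Hom K x y \<Longrightarrow> f \<in> Hom K y z \<Longrightarrow>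
        Comp K (Comp K f g) h = Comp K f (Comp K g h)"

locale normed_category = category K
  for K :: "('o, 'a) precategory" +
  fixes \<mu> :: "'a \<Rightarrow> ennreal"
  assumes norm_Ident: "x \<in> Obj K \<Longrightarrow> \<mu> (Ident K x) = 0"
    and norm_Comp: "g \<in> Hom K x y \<Longrightarrow> f \<in> Hom K y z \<Longrightarrow> \<mu> (Comp K f g) \<le> \<mu> f + \<mu> g"
    and norm_right_factor:
      "g \<in> Hom K x y \<Longrightarrow> f \<in> Hom K y z \<Longrightarrow> \<mu> g \<le> \<mu> (Comp K f g) + \<mu> f"


section \<open>Sequences, convergence and completeness\<close>

text \<open>
  \<open>bond x n m\<close> is the bonding arrow from \<open>ob x n\<close> to \<open>ob x m\<close>. It is meaningful only for
  \<open>n \<le> m\<close>; fixing it to be \<open>undefined\<close> otherwise makes a functor on \<open>\<omega>\<close> correspond to exactly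
  one sequence.
\<close>

record ('o, 'a) seq =
  ob :: "nat \<Rightarrow> 'o"
  bond :: "nat \<Rightarrow> nat \<Rightarrow> 'a"

definition is_sequence :: "('o, 'a) precategory \<Rightarrow> ('o, 'a) seq \<Rightarrow> bool" where
  "is_sequence K x \<longleftrightarrow>
    (\<forall>n. ob x n \<in> Obj K) \<and>
    (\<forall>n m. n \<le> m \<longrightarrow> bond x n m \<in> Hom K (ob x n) (ob x m)) \<and>
    (\<forall>n. bond x n n = Ident K (ob x n)) \<and>
    (\<forall>n m k. n \<le> m \<longrightarrow> m \<le> k \<longrightarrow> Comp K (bond x m k) (bond x n m) = bond x n k) \<and>
    (\<forall>n m. m < n \<longrightarrow> bond x n m = undefined)"

definition Cauchy_seq :: "('o, 'a) precategory \<Rightarrow> ('a \<Rightarrow> ennreal) \<Rightarrow> ('o, 'a) seq \<Rightarrow> bool" where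
  "Cauchy_seq K \<mu> x \<longleftrightarrow> is_sequence K x \<and>
    (\<forall>\<epsilon>::real. \<epsilon> > 0 \<longrightarrow> (\<exists>n\<^sub>0. \<forall>m n. n\<^sub>0 < m \<longrightarrow> m \<le> n \<longrightarrow> \<mu> (bond x m n) < ennreal \<epsilon>))"

definition is_cocone :: "('o, 'a) precategory \<Rightarrow> ('o, 'a) seq \<Rightarrow> 'o \<Rightarrow> (nat \<Rightarrow> 'a) \<Rightarrow> bool" where
  "is_cocone K x v g \<longleftrightarrow> v \<in> Obj K \<and> (\<forall>n. g n \<in> Hom K (ob x n) v) \<and>
    (\<forall>n m. n < m \<longrightarrow> Comp K (g m) (bond x n m) = g n)"

definition is_colimit :: "('o, 'a) precategory \<Rightarrow> ('o, 'a) seq \<Rightarrow> 'o \<Rightarrow> (nat \<Rightarrow> 'a) \<Rightarrow> bool" where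
  "is_colimit K x v g \<longleftrightarrow> is_cocone K x v g \<and>
    (\<forall>v' g'. is_cocone K x v' g' \<longrightarrow> (\<exists>!h. h \<in> Hom K v v' \<and> (\<forall>n. Comp K h (g n) = g' n)))"

definition convergent_seq :: "('o, 'a) precategory \<Rightarrow> ('a \<Rightarrow> ennreal) \<Rightarrow> ('o, 'a) seq \<Rightarrow> bool" where
  "convergent_seq K \<mu> x \<longleftrightarrow>
    (\<exists>v g. is_colimit K x v g \<and> (\<lambda>n. \<mu> (g n)) \<longlonglongrightarrow> 0)"

definition Cauchy_complete :: "('o, 'a) precategory \<Rightarrow> ('a \<Rightarrow> ennreal) \<Rightarrow> bool" where
  "Cauchy_complete K \<mu> \<longleftrightarrow> (\<forall>x. Cauchy_seq K \<mu> x \<longrightarrow> convergent_seq K \<mu> x)"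


section \<open>The category of Cauchy sequences\<close>

text \<open>
  A transformation is a pair \<open>(\<phi>, f)\<close> of an index map and a family of arrows. The self-functors
  of \<open>\<omega>\<close> used are the unbounded monotone maps. For bounded \<open>\<phi>\<close> the limit of the norms would
  violate the norm axioms (the composite of \<open>f\<close> along \<open>\<phi> = (\<lambda>n. k)\<close> with \<open>g\<close> only sees \<open>g k\<close>,
  whose norm need not be close to the norm of the tail of \<open>g\<close>).
\<close>

type_synonym 'a trans = "(nat \<Rightarrow> nat) \<times> (nat \<Rightarrow> 'a)"

definition transformations ::
    "('o, 'a) precategory \<Rightarrow> ('o, 'a) seq \<Rightarrow> ('o, 'a) seq \<Rightarrow> 'a trans set" where
  "transformations K x y = {(\<phi>, f).
    mono \<phi> \<and> filterlim \<phi> at_top sequentially \<and>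
    (\<forall>n. f n \<in> Hom K (ob x n) (ob y (\<phi> n))) \<and>
    (\<forall>m n. m < n \<longrightarrow> Comp K (bond y (\<phi> m) (\<phi> n)) (f m) = Comp K (f n) (bond x m n))}"

text \<open>
  Transformations are identified, as usual for categories of sequences, if they agree after
  moving far enough along the target sequence, so that the arrows from \<open>x\<close> to \<open>y\<close> are the elements
  of \<open>lim\<^sub>n colim\<^sub>m Hom(x\<^sub>n, y\<^sub>m)\<close>. Without this identification completeness fails: over the category
  with a single arrow, transformations are just maps \<open>\<phi>\<close>, and the sequence whose bonding
  arrows from \<open>n\<close> to \<open>m\<close> are \<open>\<lambda>k. k + (m - n)\<close> has no colimit.
\<close>

definition trans_rel ::
    "('o, 'a) precategory \<Rightarrow> ('o, 'a) seq \<Rightarrow> ('o, 'a) seq \<Rightarrow> ('a trans \<times> 'a trans) set" where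
  "trans_rel K x y = {((\<phi>, f), (\<psi>, g)).
    (\<phi>, f) \<in> transformations K x y \<and> (\<psi>, g) \<in> transformations K x y \<and>
    (\<forall>n. \<exists>m. \<phi> n \<le> m \<and> \<psi> n \<le> m \<and>
      Comp K (bond y (\<phi> n) m) (f n) = Comp K (bond y (\<psi> n) m) (g n))}"

text \<open>An arrow carries its domain and codomain along with its class of transformations.\<close>

type_synonym ('o, 'a) seq_arrow = "('o, 'a) seq \<times> ('o, 'a) seq \<times> 'a trans set"

definition sigma_ident :: "('o, 'a) precategory \<Rightarrow> ('o, 'a) seq \<Rightarrow> ('o, 'a) seq_arrow" where
  "sigma_ident K x = (x, x, trans_rel K x x `` {(\<lambda>n. n, \<lambda>n. Ident K (ob x n))})"

definition trans_comp :: "('o, 'a) precategory \<Rightarrow> 'a trans \<Rightarrow> 'a trans \<Rightarrow> 'a trans" where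
  "trans_comp K = (\<lambda>(\<psi>, g) (\<phi>, f). (\<psi> \<circ> \<phi>, \<lambda>n. Comp K (g (\<phi> n)) (f n)))"

definition sigma_comp ::
    "('o, 'a) precategory \<Rightarrow> ('o, 'a) seq_arrow \<Rightarrow> ('o, 'a) seq_arrow \<Rightarrow> ('o, 'a) seq_arrow" where
  "sigma_comp K = (\<lambda>(y, z, G) (x, y', F).
    (x, z, \<Union>s\<in>G. \<Union>t\<in>F. trans_rel K x z `` {trans_comp K s t}))"

definition sigma_cat ::
    "('o, 'a) precategory \<Rightarrow> ('a \<Rightarrow> ennreal) \<Rightarrow> (('o, 'a) seq, ('o, 'a) seq_arrow) precategory" where
  "sigma_cat K \<mu> = \<lparr>
    Obj = {x. Cauchy_seq K \<mu> x},
    Arr = {(x, y, F). Cauchy_seq K \<mu> x \<and> Cauchy_seq K \<mu> y \<and>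
      F \<in> transformations K x y // trans_rel K x y},
    Dom = fst,
    Cod = fst \<circ> snd,
    Ident = sigma_ident K,
    Comp = sigma_comp K\<rparr>"

text \<open>
  The limit exists and does not depend on the representative; see \<open>sigma_norm_LIMSEQ\<close> below.
\<close>

definition sigma_norm :: "('a \<Rightarrow> ennreal) \<Rightarrow> ('o, 'a) seq_arrow \<Rightarrow> ennreal" where
  "sigma_norm \<mu> = (\<lambda>(x, y, F). THE l. \<forall>(\<phi>, f)\<in>F. (\<lambda>n. \<mu> (f n)) \<longlonglongrightarrow> l)"


section \<open>Well-definedness\<close>

lemma ennreal_almost_mono_LIMSEQ:
  fixes a :: "nat \<Rightarrow> ennreal"
  assumes "\<And>\<epsilon>::real. \<epsilon> > 0 \<Longrightarrow> \<exists>N. \<forall>m\<ge>N. \<forall>n\<ge>m. a m \<le> a n + ennreal \<epsilon>"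
  shows "\<exists>l. a \<longlonglongrightarrow> l"
proof -
  have "limsup a \<le> liminf a"
  proof (rule ennreal_le_epsilon)
    fix \<epsilon> :: real
    assume "\<epsilon> > 0"
    then obtain N where N: "\<And>m n. N \<le> m \<Longrightarrow> m \<le> n \<Longrightarrow> a m \<le> a n + ennreal \<epsilon>"
      using assms by blast
    have "a m \<le> liminf a + ennreal \<epsilon>" if "N \<le> m" for m
    proof -
      have "a m - ennreal \<epsilon> \<le> liminf a"
        by (rule Liminf_bounded)
          (use N[OF that] in \<open>auto simp: eventually_sequentially ennreal_minus_le_iff add.commute
            intro!: exI[of _ m]\<close>)
      then show ?thesis
        by (simp add: ennreal_minus_le_iff add.commute)
    qed
    then show "limsup a \<le> liminf a + ennreal \<epsilon>"
      by (intro Limsup_bounded) (auto simp: eventually_sequentially)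
  qed
  then have "liminf a = limsup a"
    by (simp add: Liminf_le_Limsup antisym)
  then show ?thesis
    by (metis tendsto_iff_Liminf_eq_Limsup trivial_limit_sequentially)
qed

context category
begin

lemma transformationsD:
  assumes "(\<phi>, f) \<in> transformations K x y"
  shows "mono \<phi>" "filterlim \<phi> at_top sequentially" "\<And>n. f n \<in> Hom K (ob x n) (ob y (\<phi> n))"
    "\<And>m n. m < n \<Longrightarrow> Comp K (bond y (\<phi> m) (\<phi> n)) (f m) = Comp K (f n) (bond x m n)"
  using assms by (auto simp: transformations_def)

lemma sequenceD:
  assumes "is_sequence K x"
  shows "\<And>n. ob x n \<in> Obj K" "\<And>n m. n \<le> m \<Longrightarrow> bond x n m \<in> Hom K (ob x n) (ob x m)"
    "\<And>n. bond x n n = Ident K (ob x n)"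
    "\<And>n m k. n \<le> m \<Longrightarrow> m \<le> k \<Longrightarrow> Comp K (bond x m k) (bond x n m) = bond x n k"
  using assms by (auto simp: is_sequence_def)

lemma equiv_trans_rel:
  assumes y: "is_sequence K y"
  shows "equiv (transformations K x y) (trans_rel K x y)"
proof (rule equivI)
  show "trans_rel K x y \<subseteq> transformations K x y \<times> transformations K x y"
    by (auto simp: trans_rel_def)
  show "refl_on (transformations K x y) (trans_rel K x y)"
    by (auto simp: refl_on_def trans_rel_def)
  show "sym (trans_rel K x y)"
  proof (rule symI)
    fix s t
    assume st: "(s, t) \<in> trans_rel K x y"
    obtain \<phi> f \<psi> g where eqs: "s = (\<phi>, f)" "t = (\<psi>, g)"
      by (metis surj_pair)
    have "\<exists>m. \<psi> n \<le> m \<and> \<phi> n \<le> m \<and>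
        Comp K (bond y (\<psi> n) m) (g n) = Comp K (bond y (\<phi> n) m) (f n)" for n
    proof -
      obtain m where "\<phi> n \<le> m" "\<psi> n \<le> m"
        "Comp K (bond y (\<phi> n) m) (f n) = Comp K (bond y (\<psi> n) m) (g n)"
        using st by (auto simp: trans_rel_def eqs)
      then show ?thesis
        by (intro exI[of _ m]) simp
    qed
    then show "(t, s) \<in> trans_rel K x y"
      using st by (simp add: trans_rel_def eqs)
  qed
  show "trans (trans_rel K x y)"
  proof (rule transI)
    fix s t u
    assume "(s, t) \<in> trans_rel K x y" "(t, u) \<in> trans_rel K x y"
    moreover obtain \<phi> f \<psi> g \<theta> h where "s = (\<phi>, f)" "t = (\<psi>, g)" "u = (\<theta>, h)"
      by (metis surj_pair)
    ultimately have *: "((\<phi>, f), (\<psi>, g)) \<in> trans_rel K x y" "((\<psi>, g), (\<theta>, h)) \<in> trans_rel K x y"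
      and eqs: "s = (\<phi>, f)" "u = (\<theta>, h)"
      by auto
    have T: "(\<phi>, f) \<in> transformations K x y" "(\<psi>, g) \<in> transformations K x y"
      "(\<theta>, h) \<in> transformations K x y"
      using * by (auto simp: trans_rel_def)
    have push: "Comp K (bond y i r) e = Comp K (bond y p r) (Comp K (bond y i p) e)"
      if "i \<le> p" "p \<le> r" "e \<in> Hom K (ob x n) (ob y i)" for i p r e n
      using Comp_assoc[OF that(3) sequenceD(2)[OF y that(1)] sequenceD(2)[OF y that(2)]]
        sequenceD(4)[OF y that(1,2)] by simp
    have "\<exists>m. \<phi> n \<le> m \<and> \<theta> n \<le> m \<and>
        Comp K (bond y (\<phi> n) m) (f n) = Comp K (bond y (\<theta> n) m) (h n)" for n
    proof -
      obtain p where p: "\<phi> n \<le> p" "\<psi> n \<le> p"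
        "Comp K (bond y (\<phi> n) p) (f n) = Comp K (bond y (\<psi> n) p) (g n)"
        using *(1) by (auto simp: trans_rel_def)
      obtain q where q: "\<psi> n \<le> q" "\<theta> n \<le> q"
        "Comp K (bond y (\<psi> n) q) (g n) = Comp K (bond y (\<theta> n) q) (h n)"
        using *(2) by (auto simp: trans_rel_def)
      define r where "r = max p q"
      have r: "p \<le> r" "q \<le> r"
        by (auto simp: r_def)
      have "Comp K (bond y (\<phi> n) r) (f n) = Comp K (bond y (\<psi> n) r) (g n)"
        using push[OF p(1) r(1) transformationsD(3)[OF T(1)]]
          push[OF p(2) r(1) transformationsD(3)[OF T(2)]] p(3) by simp
      also have "\<dots> = Comp K (bond y (\<theta> n) r) (h n)"
        using push[OF q(1) r(2) transformationsD(3)[OF T(2)]]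
          push[OF q(2) r(2) transformationsD(3)[OF T(3)]] q(3) by simp
      finally show ?thesis
        using p(1) q(2) r by (intro exI[of _ r]) simp
    qed
    then show "(s, u) \<in> trans_rel K x y"
      using T by (simp add: trans_rel_def eqs)
  qed
qed

end

context normed_category
begin

lemma transformation_norm_convergent:
  assumes x: "Cauchy_seq K \<mu> x" and y: "Cauchy_seq K \<mu> y"
    and t: "(\<phi>, f) \<in> transformations K x y"
  shows "\<exists>l. (\<lambda>n. \<mu> (f n)) \<longlonglongrightarrow> l"
proof (rule ennreal_almost_mono_LIMSEQ)
  fix \<epsilon> :: real
  assume \<epsilon>: "\<epsilon> > 0"
  have sx: "is_sequence K x" and sy: "is_sequence K y"
    using x y by (auto simp: Cauchy_seq_def)
  obtain p where p: "\<And>m n. p < m \<Longrightarrow> m \<le> n \<Longrightarrow> \<mu> (bond x m n) < ennreal (\<epsilon> / 2)"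
    using x \<epsilon> unfolding Cauchy_seq_def by (metis half_gt_zero)
  obtain q where q: "\<And>m n. q < m \<Longrightarrow> m \<le> n \<Longrightarrow> \<mu> (bond y m n) < ennreal (\<epsilon> / 2)"
    using y \<epsilon> unfolding Cauchy_seq_def by (metis half_gt_zero)
  obtain r where r: "\<And>n. r \<le> n \<Longrightarrow> q < \<phi> n"
    using transformationsD(2)[OF t]
    unfolding filterlim_at_top eventually_sequentially by (meson Suc_le_lessD)
  have "\<mu> (f m) \<le> \<mu> (f n) + ennreal \<epsilon>" if m: "max (Suc p) r \<le> m" "m \<le> n" for m n
  proof (cases "m = n")
    case False
    then have mn: "m < n"
      using m by simp
    have le: "\<phi> m \<le> \<phi> n"
      using transformationsD(1)[OF t] m by (simp add: monoD)
    have "\<mu> (f m) \<le> \<mu> (Comp K (bond y (\<phi> m) (\<phi> n)) (f m)) + \<mu> (bond y (\<phi> m) (\<phi> n))"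
      using norm_right_factor transformationsD(3)[OF t] sequenceD(2)[OF sy le] by blast
    also have "\<dots> = \<mu> (Comp K (f n) (bond x m n)) + \<mu> (bond y (\<phi> m) (\<phi> n))"
      using transformationsD(4)[OF t mn] by simp
    also have "\<dots> \<le> (\<mu> (f n) + \<mu> (bond x m n)) + \<mu> (bond y (\<phi> m) (\<phi> n))"
      using norm_Comp[OF sequenceD(2)[OF sx m(2)] transformationsD(3)[OF t]]
      by (rule add_right_mono)
    also have "\<dots> \<le> (\<mu> (f n) + ennreal (\<epsilon> / 2)) + ennreal (\<epsilon> / 2)"
      using p[of m n] q[of "\<phi> m" "\<phi> n"] r[of m] m le by (intro add_mono) auto
    also have "\<dots> = \<mu> (f n) + ennreal \<epsilon>"
      using \<epsilon> by (simp add: add.assoc ennreal_plus[symmetric] del: ennreal_plus)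
    finally show ?thesis .
  qed simp
  then show "\<exists>N. \<forall>m\<ge>N. \<forall>n\<ge>m. \<mu> (f m) \<le> \<mu> (f n) + ennreal \<epsilon>"
    by blast
qed

lemma trans_rel_limit_le:
  assumes y: "Cauchy_seq K \<mu> y" and rel: "((\<phi>, f), (\<psi>, g)) \<in> trans_rel K x y"
    and l: "(\<lambda>n. \<mu> (f n)) \<longlonglongrightarrow> l" and l': "(\<lambda>n. \<mu> (g n)) \<longlonglongrightarrow> l'"
  shows "l \<le> l'"
proof (rule ennreal_le_epsilon)
  fix \<epsilon> :: real
  assume \<epsilon>: "\<epsilon> > 0"
  have sy: "is_sequence K y"
    using y by (auto simp: Cauchy_seq_def)
  have t: "(\<phi>, f) \<in> transformations K x y" and s: "(\<psi>, g) \<in> transformations K x y"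
    using rel by (auto simp: trans_rel_def)
  obtain q where q: "\<And>m n. q < m \<Longrightarrow> m \<le> n \<Longrightarrow> \<mu> (bond y m n) < ennreal (\<epsilon> / 2)"
    using y \<epsilon> unfolding Cauchy_seq_def by (metis half_gt_zero)
  obtain r where r: "\<And>n. r \<le> n \<Longrightarrow> q < \<phi> n"
    using transformationsD(2)[OF t]
    unfolding filterlim_at_top eventually_sequentially by (meson Suc_le_lessD)
  obtain r' where r': "\<And>n. r' \<le> n \<Longrightarrow> q < \<psi> n"
    using transformationsD(2)[OF s]
    unfolding filterlim_at_top eventually_sequentially by (meson Suc_le_lessD)
  have "\<mu> (f n) \<le> \<mu> (g n) + ennreal \<epsilon>" if n: "max r r' \<le> n" for n
  proof -
    obtain m where m: "\<phi> n \<le> m" "\<psi> n \<le> m"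
      "Comp K (bond y (\<phi> n) m) (f n) = Comp K (bond y (\<psi> n) m) (g n)"
      using rel by (auto simp: trans_rel_def)
    have "\<mu> (f n) \<le> \<mu> (Comp K (bond y (\<phi> n) m) (f n)) + \<mu> (bond y (\<phi> n) m)"
      using norm_right_factor transformationsD(3)[OF t] sequenceD(2)[OF sy m(1)] by blast
    also have "\<dots> \<le> (\<mu> (bond y (\<psi> n) m) + \<mu> (g n)) + \<mu> (bond y (\<phi> n) m)"
      unfolding m(3)
      using norm_Comp[OF transformationsD(3)[OF s] sequenceD(2)[OF sy m(2)]]
      by (rule add_right_mono)
    also have "\<dots> \<le> (ennreal (\<epsilon> / 2) + \<mu> (g n)) + ennreal (\<epsilon> / 2)"
      using q[of "\<psi> n" m] q[of "\<phi> n" m] r[of n] r'[of n] m n by (intro add_mono) auto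
    also have "\<dots> = \<mu> (g n) + ennreal \<epsilon>"
      using \<epsilon> by (simp add: add.assoc add.left_commute ennreal_plus[symmetric] del: ennreal_plus)
    finally show ?thesis .
  qed
  then have "\<forall>\<^sub>F n in sequentially. \<mu> (f n) \<le> \<mu> (g n) + ennreal \<epsilon>"
    unfolding eventually_sequentially by blast
  then show "l \<le> l' + ennreal \<epsilon>"
    by (intro tendsto_le[OF trivial_limit_sequentially tendsto_add[OF l' tendsto_const] l])
qed

lemma sigma_norm_LIMSEQ:
  assumes "(x, y, F) \<in> Arr (sigma_cat K \<mu>)" "(\<phi>, f) \<in> F"
  shows "(\<lambda>n. \<mu> (f n)) \<longlonglongrightarrow> sigma_norm \<mu> (x, y, F)"
proof -
  have x: "Cauchy_seq K \<mu> x" and y: "Cauchy_seq K \<mu> y"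
    and F: "F \<in> transformations K x y // trans_rel K x y"
    using assms(1) by (auto simp: sigma_cat_def)
  have eq: "equiv (transformations K x y) (trans_rel K x y)"
    using y by (intro equiv_trans_rel) (auto simp: Cauchy_seq_def)
  have rel: "(s, t) \<in> trans_rel K x y" if "s \<in> F" "t \<in> F" for s t
    using quotient_eq_iff[OF eq F F that] by simp
  have T: "t \<in> transformations K x y" if "t \<in> F" for t
    using F that in_quotient_imp_subset[OF eq] by blast
  obtain l where l: "(\<lambda>n. \<mu> (f n)) \<longlonglongrightarrow> l"
    using transformation_norm_convergent[OF x y T[OF assms(2)]] by blast
  have all: "(\<lambda>n. \<mu> (g n)) \<longlonglongrightarrow> l" if g: "(\<psi>, g) \<in> F" for \<psi> g
  proof -
    obtain l' where l': "(\<lambda>n. \<mu> (g n)) \<longlonglongrightarrow> l'"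
      using transformation_norm_convergent[OF x y T[OF g]] by blast
    have "l = l'"
      using trans_rel_limit_le[OF y rel[OF assms(2) g] l l']
        trans_rel_limit_le[OF y rel[OF g assms(2)] l' l] by simp
    then show ?thesis
      using l' by simp
  qed
  have "(THE l. \<forall>(\<phi>, f)\<in>F. (\<lambda>n. \<mu> (f n)) \<longlonglongrightarrow> l) = l"
  proof (rule the_equality)
    show "\<forall>(\<phi>, f)\<in>F. (\<lambda>n. \<mu> (f n)) \<longlonglongrightarrow> l"
      using all by auto
    show "l' = l" if "\<forall>(\<phi>, f)\<in>F. (\<lambda>n. \<mu> (f n)) \<longlonglongrightarrow> l'" for l'
      using that assms(2) l LIMSEQ_unique by fastforce
  qed
  then show ?thesis
    using l by (simp add: sigma_norm_def)
qed

end

end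

theory Submission
  imports Defs
begin

text \<open>
  A sequence \<open>y\<close> behaves like a formal colimit: an arrow from an object \<open>c\<close> into it is the germ of an
  arrow from \<open>c\<close> to some \<open>y\<^sub>i\<close>, where two arrows have the same germ if they agree after
  moving along the bonding arrows of \<open>y\<close>. Two transformations are identified exactly when all
  their components have the same germs, so composition and the norm axioms for the category of
  Cauchy sequences reduce to those of the base category, the norm axioms by passing to limits. It is
  essential here that index maps tend to infinity: the components \<open>g\<^bsub>\<phi>(n)\<^esub>\<close> used in a composite
  then have the same limit norm as the components \<open>g\<^sub>n\<close>.

  For completeness, take a Cauchy sequence of Cauchy sequences \<open>x\<^sub>0, x\<^sub>1, \<dots>\<close>. Choosing
  representatives of the bonding arrows between consecutive terms and composing them gives a
  family of transformations \<open>(\<phi> n m, f n m)\<close> that is functorial on the nose, not only up to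
  identification (\<open>trans_iterate_add\<close>). Such a family is the same thing as a functor on the pairs
  \<open>(n, i)\<close>, preordered by \<open>(n, i) \<le> (m, j)\<close> iff \<open>n \<le> m\<close> and \<open>\<phi> n m i \<le> j\<close>: the arrow goes from
  the \<open>i\<close>-th object of \<open>x\<^sub>n\<close> by \<open>f n m i\<close> and then along \<open>x\<^sub>m\<close> to its \<open>j\<close>-th object
  (\<open>arrow_comp\<close>). The term \<open>x\<^sub>n\<close> is the restriction of this functor to row \<open>n\<close>. If \<open>k\<close> grows
  fast enough, the pairs \<open>(n, k n)\<close> form a cofinal chain, and the restriction to that chain, the
  diagonal sequence, is a colimit: a cocone on the rows gives compatible germs on the chain,
  which can be straightened to an actual transformation (\<open>transformation_of_germs\<close>), and
  cofinality gives uniqueness (\<open>diag_jointly_epi\<close>).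

  The norms are controlled by choosing \<open>k n\<close> so large that \<open>x\<^sub>n\<close> has bonding arrows of norm below
  \<open>1 / (n + 1)\<close> from index \<open>k n\<close> on. Sliding an arrow of the functor far along both rows then
  lowers its norm by at most \<open>1 / (n + 1) + 1 / (m + 1)\<close>, while in the limit the norm is that of the
  bonding arrow from \<open>x\<^sub>n\<close> to \<open>x\<^sub>m\<close> (\<open>norm_arrow_le\<close>). This single estimate shows both that the
  diagonal is Cauchy and that the norms of the colimit arrows tend to \<open>0\<close>.
\<close>

section \<open>Germs of arrows into a sequence\<close>

text \<open>
  The equality of \<open>colim\<^sub>m Hom(c, y\<^sub>m)\<close>, on representatives \<open>a : c \<rightarrow> y\<^sub>i\<close> and \<open>b : c \<rightarrow> y\<^sub>j\<close>.
\<close>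

definition germ_eq ::
    "('o, 'a) precategory \<Rightarrow> ('o, 'a) seq \<Rightarrow> nat \<Rightarrow> 'a \<Rightarrow> nat \<Rightarrow> 'a \<Rightarrow> bool" where
  "germ_eq K y i a j b \<longleftrightarrow>
    (\<exists>p. i \<le> p \<and> j \<le> p \<and> Comp K (bond y i p) a = Comp K (bond y j p) b)"

lemma germ_eq_sym: "germ_eq K y i a j b \<Longrightarrow> germ_eq K y j b i a"
  by (force simp: germ_eq_def)

lemma trans_rel_iff_germ_eq:
  "((\<phi>, f), (\<psi>, g)) \<in> trans_rel K x y \<longleftrightarrow>
    (\<phi>, f) \<in> transformations K x y \<and> (\<psi>, g) \<in> transformations K x y \<and>
    (\<forall>n. germ_eq K y (\<phi> n) (f n) (\<psi> n) (g n))"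
  by (simp add: trans_rel_def germ_eq_def)

context category
begin

lemma bond_bond_comp:
  assumes y: "is_sequence K y" and "i \<le> p" "p \<le> r" "a \<in> Hom K c (ob y i)"
  shows "Comp K (bond y p r) (Comp K (bond y i p) a) = Comp K (bond y i r) a"
  using Comp_assoc[OF assms(4) sequenceD(2)[OF y assms(2)] sequenceD(2)[OF y assms(3)]]
    sequenceD(4)[OF y assms(2,3)] by simp

lemma bond_refl_comp:
  assumes "is_sequence K y" "a \<in> Hom K c (ob y i)"
  shows "Comp K (bond y i i) a = a"
  using assms by (simp add: sequenceD(3) Comp_Ident_left)

lemma comp_bond_refl:
  assumes "is_sequence K x" "a \<in> Hom K (ob x i) c"
  shows "Comp K a (bond x i i) = a"
  using assms by (simp add: sequenceD(3) Comp_Ident_right)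

lemma bond_comp_in_Hom:
  assumes "is_sequence K y" "i \<le> p" "a \<in> Hom K c (ob y i)"
  shows "Comp K (bond y i p) a \<in> Hom K c (ob y p)"
  using assms by (blast intro: Comp_in_Hom sequenceD(2))

lemma germ_eq_later:
  assumes y: "is_sequence K y" and a: "a \<in> Hom K c (ob y i)" and b: "b \<in> Hom K c (ob y j)"
    and eq: "Comp K (bond y i p) a = Comp K (bond y j p) b" and le: "i \<le> p" "j \<le> p" "p \<le> r"
  shows "Comp K (bond y i r) a = Comp K (bond y j r) b"
  using bond_bond_comp[OF y le(1,3) a] bond_bond_comp[OF y le(2,3) b] eq by simp

lemma germ_eq_trans:
  assumes y: "is_sequence K y"
    and a: "a \<in> Hom K c (ob y i)" and b: "b \<in> Hom K c (ob y j)" and d: "d \<in> Hom K c (ob y l)"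
    and ab: "germ_eq K y i a j b" and bd: "germ_eq K y j b l d"
  shows "germ_eq K y i a l d"
proof -
  obtain p where p: "i \<le> p" "j \<le> p" "Comp K (bond y i p) a = Comp K (bond y j p) b"
    using ab by (auto simp: germ_eq_def)
  obtain q where q: "j \<le> q" "l \<le> q" "Comp K (bond y j q) b = Comp K (bond y l q) d"
    using bd by (auto simp: germ_eq_def)
  have "Comp K (bond y i (max p q)) a = Comp K (bond y l (max p q)) d"
    using germ_eq_later[OF y a b p(3) p(1,2), of "max p q"]
      germ_eq_later[OF y b d q(3) q(1,2), of "max p q"] by simp
  then show ?thesis
    using p q unfolding germ_eq_def by (intro exI[of _ "max p q"]) auto
qed

lemma germ_eq_bond:
  assumes "is_sequence K y" "a \<in> Hom K c (ob y i)" "i \<le> p"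
  shows "germ_eq K y i a p (Comp K (bond y i p) a)"
  unfolding germ_eq_def
  using assms by (intro exI[of _ p]) (simp add: bond_bond_comp)

lemma germ_eq_precomp:
  assumes y: "is_sequence K y" and e: "e \<in> Hom K b c"
    and a: "a \<in> Hom K c (ob y i)" and a': "a' \<in> Hom K c (ob y j)"
    and eq: "germ_eq K y i a j a'"
  shows "germ_eq K y i (Comp K a e) j (Comp K a' e)"
proof -
  obtain p where p: "i \<le> p" "j \<le> p" "Comp K (bond y i p) a = Comp K (bond y j p) a'"
    using eq by (auto simp: germ_eq_def)
  have "Comp K (bond y i p) (Comp K a e) = Comp K (bond y j p) (Comp K a' e)"
    using Comp_assoc[OF e a sequenceD(2)[OF y p(1)]] Comp_assoc[OF e a' sequenceD(2)[OF y p(2)]]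
      p(3) by simp
  with p show ?thesis
    unfolding germ_eq_def by blast
qed

lemma transformation_natural:
  assumes x: "is_sequence K x" and y: "is_sequence K y"
    and t: "(\<phi>, f) \<in> transformations K x y" and "m \<le> n"
  shows "Comp K (bond y (\<phi> m) (\<phi> n)) (f m) = Comp K (f n) (bond x m n)"
proof (cases "m = n")
  case True
  then show ?thesis
    using bond_refl_comp[OF y transformationsD(3)[OF t]]
      comp_bond_refl[OF x transformationsD(3)[OF t]] by simp
next
  case False
  then show ?thesis
    using transformationsD(4)[OF t] \<open>m \<le> n\<close> by simp
qed

lemma transformation_comp_bond:
  assumes y: "is_sequence K y" and z: "is_sequence K z"
    and s: "(\<psi>, g) \<in> transformations K y z" and a: "a \<in> Hom K c (ob y i)" and "i \<le> p"
  shows "Comp K (g p) (Comp K (bond y i p) a) = Comp K (bond z (\<psi> i) (\<psi> p)) (Comp K (g i) a)"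
proof -
  have le: "\<psi> i \<le> \<psi> p"
    using transformationsD(1)[OF s] \<open>i \<le> p\<close> by (simp add: monoD)
  show ?thesis
    using Comp_assoc[OF a sequenceD(2)[OF y \<open>i \<le> p\<close>] transformationsD(3)[OF s]]
      Comp_assoc[OF a transformationsD(3)[OF s] sequenceD(2)[OF z le]]
      transformation_natural[OF y z s \<open>i \<le> p\<close>] by simp
qed

lemma germ_eq_postcomp:
  assumes y: "is_sequence K y" and z: "is_sequence K z"
    and s: "(\<psi>, g) \<in> transformations K y z"
    and a: "a \<in> Hom K c (ob y i)" and b: "b \<in> Hom K c (ob y j)"
    and eq: "germ_eq K y i a j b"
  shows "germ_eq K z (\<psi> i) (Comp K (g i) a) (\<psi> j) (Comp K (g j) b)"
proof -
  obtain p where p: "i \<le> p" "j \<le> p" "Comp K (bond y i p) a = Comp K (bond y j p) b"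
    using eq by (auto simp: germ_eq_def)
  have "Comp K (bond z (\<psi> i) (\<psi> p)) (Comp K (g i) a) =
      Comp K (bond z (\<psi> j) (\<psi> p)) (Comp K (g j) b)"
    using transformation_comp_bond[OF y z s a p(1)] transformation_comp_bond[OF y z s b p(2)] p(3)
    by simp
  moreover have "\<psi> i \<le> \<psi> p" "\<psi> j \<le> \<psi> p"
    using transformationsD(1)[OF s] p by (auto simp: monoD)
  ultimately show ?thesis
    unfolding germ_eq_def by blast
qed

lemma germ_eq_transformation:
  assumes x: "is_sequence K x" and y: "is_sequence K y"
    and t: "(\<phi>, f) \<in> transformations K x y" and "m \<le> n"
  shows "germ_eq K y (\<phi> m) (f m) (\<phi> n) (Comp K (f n) (bond x m n))"
  using germ_eq_bond[OF y transformationsD(3)[OF t], of m "\<phi> n"]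
    transformation_natural[OF x y t \<open>m \<le> n\<close>] transformationsD(1)[OF t] \<open>m \<le> n\<close>
  by (simp add: monoD)

lemma transformationI_Suc:
  assumes x: "is_sequence K x" and y: "is_sequence K y"
    and \<phi>: "mono \<phi>" "filterlim \<phi> at_top sequentially"
    and f: "\<And>n. f n \<in> Hom K (ob x n) (ob y (\<phi> n))"
    and nat: "\<And>n. Comp K (bond y (\<phi> n) (\<phi> (Suc n))) (f n) = Comp K (f (Suc n)) (bond x n (Suc n))"
  shows "(\<phi>, f) \<in> transformations K x y"
proof -
  have "Comp K (bond y (\<phi> m) (\<phi> n)) (f m) = Comp K (f n) (bond x m n)" if "m \<le> n" for m n
    using that
  proof (induction n rule: dec_induct)
    case base
    show ?case
      using bond_refl_comp[OF y f] comp_bond_refl[OF x f] by simp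
  next
    case (step n)
    have le: "\<phi> m \<le> \<phi> n" "\<phi> n \<le> \<phi> (Suc n)"
      using \<phi>(1) step.hyps by (auto simp: monoD)
    have "Comp K (bond y (\<phi> m) (\<phi> (Suc n))) (f m) =
        Comp K (bond y (\<phi> n) (\<phi> (Suc n))) (Comp K (bond y (\<phi> m) (\<phi> n)) (f m))"
      using bond_bond_comp[OF y le f] by simp
    also have "\<dots> = Comp K (bond y (\<phi> n) (\<phi> (Suc n))) (Comp K (f n) (bond x m n))"
      using step.IH by simp
    also have "\<dots> = Comp K (Comp K (f (Suc n)) (bond x n (Suc n))) (bond x m n)"
      using Comp_assoc[OF sequenceD(2)[OF x step.hyps(1)] f sequenceD(2)[OF y le(2)]] nat by simp
    also have "\<dots> = Comp K (f (Suc n)) (bond x m (Suc n))"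
      using Comp_assoc[OF sequenceD(2)[OF x step.hyps(1)] sequenceD(2)[OF x, of n "Suc n"] f]
        sequenceD(4)[OF x step.hyps(1), of "Suc n"] by simp
    finally show ?case .
  qed
  then show ?thesis
    using \<phi> f by (simp add: transformations_def)
qed

text \<open>
  A family of germs that is natural only up to germ equality becomes strictly natural once each
  component is pushed far enough along \<open>y\<close>. It suffices to reach an index \<open>p n\<close> at which the
  naturality square from \<open>n\<close> to \<open>n + 1\<close> commutes, because the square is only tested at the later
  index belonging to \<open>n + 1\<close>.
\<close>

lemma transformation_of_germs:
  assumes x: "is_sequence K x" and y: "is_sequence K y"
    and h: "\<And>n. h n \<in> Hom K (ob x n) (ob y (\<eta> n))"
    and compat: "\<And>n. germ_eq K y (\<eta> n) (h n) (\<eta> (Suc n)) (Comp K (h (Suc n)) (bond x n (Suc n)))"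
  obtains \<alpha> u where "(\<alpha>, u) \<in> transformations K x y"
    "\<And>n. germ_eq K y (\<alpha> n) (u n) (\<eta> n) (h n)"
proof -
  have "\<exists>p. \<forall>n. \<eta> n \<le> p n \<and> \<eta> (Suc n) \<le> p n \<and> Comp K (bond y (\<eta> n) (p n)) (h n) =
      Comp K (bond y (\<eta> (Suc n)) (p n)) (Comp K (h (Suc n)) (bond x n (Suc n)))"
    using compat unfolding germ_eq_def by (intro choice) blast
  then obtain p where p: "\<And>n. \<eta> n \<le> p n" "\<And>n. \<eta> (Suc n) \<le> p n"
    "\<And>n. Comp K (bond y (\<eta> n) (p n)) (h n) =
      Comp K (bond y (\<eta> (Suc n)) (p n)) (Comp K (h (Suc n)) (bond x n (Suc n)))"
    by blast
  \<comment> \<open>The sum makes the index map monotone and at least \<open>p\<close>; the summand \<open>n\<close> makes it unbounded.\<close>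
  define \<alpha> where "\<alpha> n = n + (\<Sum>i\<le>n. p i)" for n
  define u where "u n = Comp K (bond y (\<eta> n) (\<alpha> n)) (h n)" for n
  have mono: "mono \<alpha>"
    by (rule monoI) (auto simp: \<alpha>_def intro!: add_mono sum_mono2)
  have lim: "filterlim \<alpha> at_top sequentially"
    by (rule filterlim_at_top_mono[OF filterlim_ident]) (simp add: \<alpha>_def)
  have p\<alpha>: "p n \<le> \<alpha> n" for n
    using member_le_sum[of n "{..n}" p] by (simp add: \<alpha>_def)
  then have \<eta>\<alpha>: "\<eta> n \<le> \<alpha> n" for n
    using p(1) le_trans by blast
  have u: "u n \<in> Hom K (ob x n) (ob y (\<alpha> n))" for n
    unfolding u_def by (rule bond_comp_in_Hom[OF y \<eta>\<alpha> h])
  have nat: "Comp K (bond y (\<alpha> n) (\<alpha> (Suc n))) (u n) = Comp K (u (Suc n)) (bond x n (Suc n))" for n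
  proof -
    have xb: "bond x n (Suc n) \<in> Hom K (ob x n) (ob x (Suc n))"
      by (simp add: sequenceD(2)[OF x])
    have le: "\<alpha> n \<le> \<alpha> (Suc n)"
      using mono by (simp add: monoD)
    have "Comp K (bond y (\<alpha> n) (\<alpha> (Suc n))) (u n) = Comp K (bond y (\<eta> n) (\<alpha> (Suc n))) (h n)"
      unfolding u_def by (rule bond_bond_comp[OF y \<eta>\<alpha> le h])
    also have "\<dots> = Comp K (bond y (\<eta> (Suc n)) (\<alpha> (Suc n))) (Comp K (h (Suc n)) (bond x n (Suc n)))"
      by (rule germ_eq_later[OF y h Comp_in_Hom[OF xb h] p(3) p(1,2)])
        (use p\<alpha> le le_trans in blast)
    also have "\<dots> = Comp K (u (Suc n)) (bond x n (Suc n))"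
      unfolding u_def using Comp_assoc[OF xb h sequenceD(2)[OF y \<eta>\<alpha>]] by simp
    finally show ?thesis .
  qed
  show thesis
  proof (rule that)
    show "(\<alpha>, u) \<in> transformations K x y"
      by (rule transformationI_Suc[OF x y mono lim u nat])
    show "germ_eq K y (\<alpha> n) (u n) (\<eta> n) (h n)" for n
      unfolding u_def by (rule germ_eq_sym[OF germ_eq_bond[OF y h \<eta>\<alpha>]])
  qed
qed

end


section \<open>The category of transformations\<close>

definition trans_ident :: "('o, 'a) precategory \<Rightarrow> ('o, 'a) seq \<Rightarrow> 'a trans" where
  "trans_ident K x = (\<lambda>n. n, \<lambda>n. Ident K (ob x n))"

lemma trans_comp_Pair: "trans_comp K (\<psi>, g) (\<phi>, f) = (\<lambda>n. \<psi> (\<phi> n), \<lambda>n. Comp K (g (\<phi> n)) (f n))"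
  by (simp add: trans_comp_def comp_def)

context category
begin

lemma trans_ident_in:
  assumes x: "is_sequence K x"
  shows "trans_ident K x \<in> transformations K x x"
  using sequenceD[OF x]
  by (auto simp: transformations_def trans_ident_def Ident_in_Hom filterlim_ident
      Comp_Ident_left[OF sequenceD(2)[OF x]] Comp_Ident_right[OF sequenceD(2)[OF x]] intro: monoI)

lemma trans_comp_in:
  assumes x: "is_sequence K x" and y: "is_sequence K y" and z: "is_sequence K z"
    and s: "s \<in> transformations K y z" and t: "t \<in> transformations K x y"
  shows "trans_comp K s t \<in> transformations K x z"
proof -
  obtain \<psi> g \<phi> f where st: "s = (\<psi>, g)" "t = (\<phi>, f)"
    by (metis surj_pair)
  note s = s[unfolded st] and t = t[unfolded st]
  show ?thesis
    unfolding st trans_comp_Pair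
  proof (rule transformationI_Suc[OF x z])
    show "mono (\<lambda>n. \<psi> (\<phi> n))"
      using transformationsD(1)[OF s] transformationsD(1)[OF t] by (simp add: mono_def)
    show "filterlim (\<lambda>n. \<psi> (\<phi> n)) at_top sequentially"
      using transformationsD(2)[OF s] transformationsD(2)[OF t] by (rule filterlim_compose)
    show "Comp K (g (\<phi> n)) (f n) \<in> Hom K (ob x n) (ob z (\<psi> (\<phi> n)))" for n
      using transformationsD(3)[OF s] transformationsD(3)[OF t] by (blast intro: Comp_in_Hom)
    show "Comp K (bond z (\<psi> (\<phi> n)) (\<psi> (\<phi> (Suc n)))) (Comp K (g (\<phi> n)) (f n)) =
        Comp K (Comp K (g (\<phi> (Suc n))) (f (Suc n))) (bond x n (Suc n))" for n
    proof -
      have le: "\<phi> n \<le> \<phi> (Suc n)"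
        using transformationsD(1)[OF t] by (simp add: monoD)
      have "Comp K (bond z (\<psi> (\<phi> n)) (\<psi> (\<phi> (Suc n)))) (Comp K (g (\<phi> n)) (f n)) =
          Comp K (g (\<phi> (Suc n))) (Comp K (bond y (\<phi> n) (\<phi> (Suc n))) (f n))"
        using transformation_comp_bond[OF y z s transformationsD(3)[OF t] le] by simp
      also have "\<dots> = Comp K (g (\<phi> (Suc n))) (Comp K (f (Suc n)) (bond x n (Suc n)))"
        using transformation_natural[OF x y t, of n "Suc n"] by simp
      also have "\<dots> = Comp K (Comp K (g (\<phi> (Suc n))) (f (Suc n))) (bond x n (Suc n))"
        using Comp_assoc[OF sequenceD(2)[OF x, of n "Suc n"] transformationsD(3)[OF t]
            transformationsD(3)[OF s]] by simp
      finally show ?thesis .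
    qed
  qed
qed

lemma trans_comp_ident_right:
  assumes "t \<in> transformations K x y"
  shows "trans_comp K t (trans_ident K x) = t"
  using assms
  by (auto simp: trans_ident_def trans_comp_def transformations_def fun_eq_iff comp_def
      intro: Comp_Ident_right)

lemma trans_comp_ident_left:
  assumes "t \<in> transformations K x y"
  shows "trans_comp K (trans_ident K y) t = t"
  using assms
  by (auto simp: trans_ident_def trans_comp_def transformations_def fun_eq_iff comp_def
      intro: Comp_Ident_left)

lemma trans_comp_assoc:
  assumes "r \<in> transformations K w x" "t \<in> transformations K x y" "s \<in> transformations K y z"
  shows "trans_comp K (trans_comp K s t) r = trans_comp K s (trans_comp K t r)"
proof -
  obtain \<psi> g \<phi> f \<theta> h where eqs: "s = (\<psi>, g)" "t = (\<phi>, f)" "r = (\<theta>, h)"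
    by (metis surj_pair)
  show ?thesis
    using Comp_assoc[OF transformationsD(3)[OF assms(1)[unfolded eqs]]
        transformationsD(3)[OF assms(2)[unfolded eqs]] transformationsD(3)[OF assms(3)[unfolded eqs]]]
    by (simp add: eqs trans_comp_Pair)
qed

text \<open>
  Replacing \<open>t\<close> by \<open>t'\<close> is harmless because \<open>s\<close> preserves germ equality, replacing \<open>s\<close> by \<open>s'\<close>
  because germ equality is stable under precomposition.
\<close>

lemma trans_comp_cong:
  assumes x: "is_sequence K x" and y: "is_sequence K y" and z: "is_sequence K z"
    and s: "(s, s') \<in> trans_rel K y z" and t: "(t, t') \<in> trans_rel K x y"
  shows "(trans_comp K s t, trans_comp K s' t') \<in> trans_rel K x z"
proof -
  obtain \<psi> g \<phi> f \<psi>' g' \<phi>' f' where eqs: "s = (\<psi>, g)" "t = (\<phi>, f)" "s' = (\<psi>', g')" "t' = (\<phi>', f')"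
    by (metis surj_pair)
  have S: "(\<psi>, g) \<in> transformations K y z" "(\<psi>', g') \<in> transformations K y z"
    and T: "(\<phi>, f) \<in> transformations K x y" "(\<phi>', f') \<in> transformations K x y"
    and gS: "germ_eq K z (\<psi> n) (g n) (\<psi>' n) (g' n)"
    and gT: "germ_eq K y (\<phi> n) (f n) (\<phi>' n) (f' n)" for n
    using s t by (auto simp: eqs trans_rel_iff_germ_eq)
  have g: "germ_eq K z (\<psi> (\<phi> n)) (Comp K (g (\<phi> n)) (f n)) (\<psi>' (\<phi>' n)) (Comp K (g' (\<phi>' n)) (f' n))" for n
    by (rule germ_eq_trans[OF z _ _ _
          germ_eq_postcomp[OF y z S(1) transformationsD(3)[OF T(1)] transformationsD(3)[OF T(2)] gT]
          germ_eq_precomp[OF z transformationsD(3)[OF T(2)] transformationsD(3)[OF S(1)]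
            transformationsD(3)[OF S(2)] gS]])
      (rule Comp_in_Hom transformationsD(3)[OF S(1)] transformationsD(3)[OF S(2)]
        transformationsD(3)[OF T(1)] transformationsD(3)[OF T(2)])+
  show ?thesis
    using g trans_comp_in[OF x y z S(1) T(1)] trans_comp_in[OF x y z S(2) T(2)]
    by (simp add: eqs trans_comp_Pair trans_rel_iff_germ_eq)
qed

end


section \<open>The normed category of Cauchy sequences\<close>

definition sigma_class ::
    "('o, 'a) precategory \<Rightarrow> ('o, 'a) seq \<Rightarrow> ('o, 'a) seq \<Rightarrow> 'a trans \<Rightarrow> ('o, 'a) seq_arrow" where
  "sigma_class K x y t = (x, y, trans_rel K x y `` {t})"

lemma Cauchy_seq_is_sequence: "Cauchy_seq K \<mu> x \<Longrightarrow> is_sequence K x"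
  by (simp add: Cauchy_seq_def)

lemma Obj_sigma_cat: "Obj (sigma_cat K \<mu>) = {x. Cauchy_seq K \<mu> x}"
  by (simp add: sigma_cat_def)

lemma Ident_sigma_cat: "Ident (sigma_cat K \<mu>) x = sigma_class K x x (trans_ident K x)"
  by (simp add: sigma_cat_def sigma_ident_def sigma_class_def trans_ident_def)

lemma Hom_sigma_cat:
  "F \<in> Hom (sigma_cat K \<mu>) x y \<longleftrightarrow> Cauchy_seq K \<mu> x \<and> Cauchy_seq K \<mu> y \<and>
    (\<exists>t\<in>transformations K x y. F = sigma_class K x y t)"
  by (auto simp: Hom_def sigma_cat_def sigma_class_def quotient_def)

lemma sigma_class_in_Hom:
  assumes "Cauchy_seq K \<mu> x" "Cauchy_seq K \<mu> y" "t \<in> transformations K x y"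
  shows "sigma_class K x y t \<in> Hom (sigma_cat K \<mu>) x y"
  using assms by (auto simp: Hom_sigma_cat)

lemma Hom_sigma_catE:
  assumes "F \<in> Hom (sigma_cat K \<mu>) x y"
  obtains t where "Cauchy_seq K \<mu> x" "Cauchy_seq K \<mu> y" "t \<in> transformations K x y"
    "F = sigma_class K x y t"
  using assms by (auto simp: Hom_sigma_cat)

context category
begin

lemma sigma_class_eq_iff:
  assumes "is_sequence K y" "s \<in> transformations K x y" "t \<in> transformations K x y"
  shows "sigma_class K x y s = sigma_class K x y t \<longleftrightarrow> (s, t) \<in> trans_rel K x y"
  using eq_equiv_class_iff[OF equiv_trans_rel[OF assms(1)] assms(2,3)]
  by (simp add: sigma_class_def)

lemma Comp_sigma_class:
  assumes x: "is_sequence K x" and y: "is_sequence K y" and z: "is_sequence K z"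
    and s: "s \<in> transformations K y z" and t: "t \<in> transformations K x y"
  shows "Comp (sigma_cat K \<mu>) (sigma_class K y z s) (sigma_class K x y t) =
    sigma_class K x z (trans_comp K s t)"
proof -
  have "trans_rel K x z `` {trans_comp K s' t'} = trans_rel K x z `` {trans_comp K s t}"
    if "(s, s') \<in> trans_rel K y z" "(t, t') \<in> trans_rel K x y" for s' t'
    using equiv_class_eq[OF equiv_trans_rel[OF z] trans_comp_cong[OF x y z that]] by simp
  moreover have "(s, s) \<in> trans_rel K y z" "(t, t) \<in> trans_rel K x y"
    using equiv_trans_rel[OF y] equiv_trans_rel[OF z] s t by (meson equivE refl_onD)+
  ultimately have "(\<Union>s'\<in>trans_rel K y z `` {s}. \<Union>t'\<in>trans_rel K x y `` {t}.
      trans_rel K x z `` {trans_comp K s' t'}) = trans_rel K x z `` {trans_comp K s t}"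
    by blast
  then show ?thesis
    by (simp add: sigma_cat_def sigma_comp_def sigma_class_def)
qed

end

context normed_category
begin

lemma category_sigma_cat: "category (sigma_cat K \<mu>)"
proof
  fix f
  assume "f \<in> Arr (sigma_cat K \<mu>)"
  then show "Dom (sigma_cat K \<mu>) f \<in> Obj (sigma_cat K \<mu>)"
    "Cod (sigma_cat K \<mu>) f \<in> Obj (sigma_cat K \<mu>)"
    by (auto simp: sigma_cat_def)
next
  fix x
  assume "x \<in> Obj (sigma_cat K \<mu>)"
  then show "Ident (sigma_cat K \<mu>) x \<in> Hom (sigma_cat K \<mu>) x x"
    by (simp add: Obj_sigma_cat Ident_sigma_cat sigma_class_in_Hom trans_ident_in
        Cauchy_seq_is_sequence)
next
  fix f g x y z
  assume g: "g \<in> Hom (sigma_cat K \<mu>) x y" and f: "f \<in> Hom (sigma_cat K \<mu>) y z"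
  from g f show "Comp (sigma_cat K \<mu>) f g \<in> Hom (sigma_cat K \<mu>) x z"
    by (elim Hom_sigma_catE)
      (auto simp: Comp_sigma_class Cauchy_seq_is_sequence
        intro!: sigma_class_in_Hom intro: trans_comp_in Cauchy_seq_is_sequence)
next
  fix f x y
  assume f: "f \<in> Hom (sigma_cat K \<mu>) x y"
  from f show "Comp (sigma_cat K \<mu>) f (Ident (sigma_cat K \<mu>) x) = f"
    by (elim Hom_sigma_catE) (simp add: Ident_sigma_cat Comp_sigma_class Cauchy_seq_is_sequence
        trans_ident_in trans_comp_ident_right)
  from f show "Comp (sigma_cat K \<mu>) (Ident (sigma_cat K \<mu>) y) f = f"
    by (elim Hom_sigma_catE) (simp add: Ident_sigma_cat Comp_sigma_class Cauchy_seq_is_sequence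
        trans_ident_in trans_comp_ident_left)
next
  fix f g h w x y z
  assume h: "h \<in> Hom (sigma_cat K \<mu>) w x" and g: "g \<in> Hom (sigma_cat K \<mu>) x y"
    and f: "f \<in> Hom (sigma_cat K \<mu>) y z"
  from h g f show "Comp (sigma_cat K \<mu>) (Comp (sigma_cat K \<mu>) f g) h =
      Comp (sigma_cat K \<mu>) f (Comp (sigma_cat K \<mu>) g h)"
  proof (elim Hom_sigma_catE)
    fix r t s
    assume w: "Cauchy_seq K \<mu> w" and x: "Cauchy_seq K \<mu> x" and y: "Cauchy_seq K \<mu> y"
      and z: "Cauchy_seq K \<mu> z"
      and r: "r \<in> transformations K w x" and t: "t \<in> transformations K x y"
      and s: "s \<in> transformations K y z"
      and eqs: "h = sigma_class K w x r" "g = sigma_class K x y t" "f = sigma_class K y z s"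
    note seqs = w[THEN Cauchy_seq_is_sequence] x[THEN Cauchy_seq_is_sequence]
      y[THEN Cauchy_seq_is_sequence] z[THEN Cauchy_seq_is_sequence]
    show ?thesis
      using trans_comp_in[OF seqs(2,3,4) s t] trans_comp_in[OF seqs(1,2,3) t r]
      by (simp add: eqs Comp_sigma_class seqs r t s trans_comp_assoc[OF r t s])
  qed
qed

lemma sigma_norm_class_LIMSEQ:
  assumes "Cauchy_seq K \<mu> x" "Cauchy_seq K \<mu> y" "(\<phi>, f) \<in> transformations K x y"
  shows "(\<lambda>n. \<mu> (f n)) \<longlonglongrightarrow> sigma_norm \<mu> (sigma_class K x y (\<phi>, f))"
  unfolding sigma_class_def
proof (rule sigma_norm_LIMSEQ)
  show "(x, y, trans_rel K x y `` {(\<phi>, f)}) \<in> Arr (sigma_cat K \<mu>)"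
    using assms by (auto simp: sigma_cat_def intro: quotientI)
  show "(\<phi>, f) \<in> trans_rel K x y `` {(\<phi>, f)}"
    using equiv_class_self[OF equiv_trans_rel[OF Cauchy_seq_is_sequence[OF assms(2)]] assms(3)] .
qed

lemma normed_category_sigma: "normed_category (sigma_cat K \<mu>) (sigma_norm \<mu>)"
proof -
  interpret S: category "sigma_cat K \<mu>"
    by (rule category_sigma_cat)
  show ?thesis
  proof
    fix x
    assume "x \<in> Obj (sigma_cat K \<mu>)"
    then have x: "Cauchy_seq K \<mu> x"
      by (simp add: Obj_sigma_cat)
    have "(\<lambda>n. \<mu> (Ident K (ob x n))) \<longlonglongrightarrow> sigma_norm \<mu> (Ident (sigma_cat K \<mu>) x)"
      using sigma_norm_class_LIMSEQ[OF x x trans_ident_in[unfolded trans_ident_def]] x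
      by (simp add: Ident_sigma_cat trans_ident_def Cauchy_seq_is_sequence)
    then show "sigma_norm \<mu> (Ident (sigma_cat K \<mu>) x) = 0"
      using x by (simp add: norm_Ident sequenceD(1) Cauchy_seq_is_sequence LIMSEQ_const_iff)
  next
    fix F G x y z
    assume G: "G \<in> Hom (sigma_cat K \<mu>) x y" and F: "F \<in> Hom (sigma_cat K \<mu>) y z"
    obtain \<phi> g where g: "(\<phi>, g) \<in> transformations K x y" "G = sigma_class K x y (\<phi>, g)"
      and x: "Cauchy_seq K \<mu> x" and y: "Cauchy_seq K \<mu> y"
      using G by (metis Hom_sigma_catE surj_pair)
    obtain \<psi> f where f: "(\<psi>, f) \<in> transformations K y z" "F = sigma_class K y z (\<psi>, f)"
      and z: "Cauchy_seq K \<mu> z"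
      using F by (metis Hom_sigma_catE surj_pair)
    note seqs = x[THEN Cauchy_seq_is_sequence] y[THEN Cauchy_seq_is_sequence]
      z[THEN Cauchy_seq_is_sequence]
    have limG: "(\<lambda>n. \<mu> (g n)) \<longlonglongrightarrow> sigma_norm \<mu> G"
      using sigma_norm_class_LIMSEQ[OF x y g(1)] g(2) by simp
    have limF: "(\<lambda>n. \<mu> (f (\<phi> n))) \<longlonglongrightarrow> sigma_norm \<mu> F"
      using filterlim_compose[OF sigma_norm_class_LIMSEQ[OF y z f(1)] transformationsD(2)[OF g(1)]]
        f(2) by simp
    have limFG: "(\<lambda>n. \<mu> (Comp K (f (\<phi> n)) (g n))) \<longlonglongrightarrow> sigma_norm \<mu> (Comp (sigma_cat K \<mu>) F G)"
      using sigma_norm_class_LIMSEQ[OF x z trans_comp_in[OF seqs f(1) g(1), unfolded trans_comp_Pair]]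
      by (simp add: f(2) g(2) Comp_sigma_class[OF seqs f(1) g(1)] trans_comp_Pair)
    note Homs = transformationsD(3)[OF g(1)] transformationsD(3)[OF f(1)]
    show "sigma_norm \<mu> (Comp (sigma_cat K \<mu>) F G) \<le> sigma_norm \<mu> F + sigma_norm \<mu> G"
      by (rule LIMSEQ_le[OF limFG tendsto_add[OF limF limG]]) (use norm_Comp[OF Homs] in blast)
    show "sigma_norm \<mu> G \<le> sigma_norm \<mu> (Comp (sigma_cat K \<mu>) F G) + sigma_norm \<mu> F"
      by (rule LIMSEQ_le[OF limG tendsto_add[OF limFG limF]])
        (use norm_right_factor[OF Homs] in blast)
  qed
qed

end


section \<open>Sequences of transformations as functors on a poset of pairs\<close>

text \<open>
  A functor from \<open>\<omega>\<close> to sequences and transformations, with equalities of transformations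
  rather than of their classes.
\<close>

locale transformation_sequence = category K
  for K :: "('o, 'a) precategory" +
  fixes x :: "nat \<Rightarrow> ('o, 'a) seq"
    and \<phi> :: "nat \<Rightarrow> nat \<Rightarrow> nat \<Rightarrow> nat"
    and f :: "nat \<Rightarrow> nat \<Rightarrow> nat \<Rightarrow> 'a"
  assumes term_sequence: "is_sequence K (x n)"
    and term_trans: "n \<le> m \<Longrightarrow> (\<phi> n m, f n m) \<in> transformations K (x n) (x m)"
    and term_refl: "(\<phi> n n, f n n) = trans_ident K (x n)"
    and term_comp: "n \<le> m \<Longrightarrow> m \<le> p \<Longrightarrow>
      trans_comp K (\<phi> m p, f m p) (\<phi> n m, f n m) = (\<phi> n p, f n p)"
begin

text \<open>
  The preorder on pairs in which \<open>(n, i)\<close> precedes \<open>(m, j)\<close> if the transformation from \<open>x n\<close> to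
  \<open>x m\<close> lands at or before index \<open>j\<close>; on it \<open>arrow\<close> is a functor.
\<close>

definition below :: "nat \<Rightarrow> nat \<Rightarrow> nat \<Rightarrow> nat \<Rightarrow> bool" where
  "below n i m j \<longleftrightarrow> n \<le> m \<and> \<phi> n m i \<le> j"

definition arrow :: "nat \<Rightarrow> nat \<Rightarrow> nat \<Rightarrow> nat \<Rightarrow> 'a" where
  "arrow n i m j = Comp K (bond (x m) (\<phi> n m i) j) (f n m i)"

lemma index_refl: "\<phi> n n i = i"
  using term_refl[of n] by (simp add: trans_ident_def)

lemma index_comp: "n \<le> m \<Longrightarrow> m \<le> p \<Longrightarrow> \<phi> m p (\<phi> n m i) = \<phi> n p i"
  using term_comp[of n m p] by (auto simp: trans_comp_Pair fun_eq_iff)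

lemma family_comp: "n \<le> m \<Longrightarrow> m \<le> p \<Longrightarrow> Comp K (f m p (\<phi> n m i)) (f n m i) = f n p i"
  using term_comp[of n m p] by (auto simp: trans_comp_Pair fun_eq_iff)

lemma index_mono: "n \<le> m \<Longrightarrow> i \<le> j \<Longrightarrow> \<phi> n m i \<le> \<phi> n m j"
  using transformationsD(1)[OF term_trans] by (simp add: monoD)

lemma family_in_Hom: "n \<le> m \<Longrightarrow> f n m i \<in> Hom K (ob (x n) i) (ob (x m) (\<phi> n m i))"
  by (rule transformationsD(3)[OF term_trans])

lemma below_trans:
  assumes "below n i m j" "below m j p l"
  shows "below n i p l"
proof -
  have "\<phi> n p i \<le> \<phi> m p j"
    using assms index_comp[of n m p i] index_mono[of m p "\<phi> n m i" j] by (simp add: below_def)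
  then show ?thesis
    using assms by (simp add: below_def)
qed

lemma below_same: "below n i n j \<longleftrightarrow> i \<le> j"
  by (simp add: below_def index_refl)

lemma arrow_in_Hom: "below n i m j \<Longrightarrow> arrow n i m j \<in> Hom K (ob (x n) i) (ob (x m) j)"
  unfolding arrow_def below_def
  by (blast intro: bond_comp_in_Hom[OF term_sequence] family_in_Hom)

text \<open>
  Naturality of \<open>f m p\<close> moves the bonding arrow of \<open>x m\<close> in the middle over to \<open>x p\<close>, where it is
  absorbed by the last bonding arrow.
\<close>

lemma arrow_comp:
  assumes nm: "below n i m j" and mp: "below m j p l"
  shows "Comp K (arrow m j p l) (arrow n i m j) = arrow n i p l"
proof -
  have le: "n \<le> m" "\<phi> n m i \<le> j" "m \<le> p" "\<phi> m p j \<le> l"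
    using nm mp by (auto simp: below_def)
  have "Comp K (arrow m j p l) (arrow n i m j) =
      Comp K (bond (x p) (\<phi> m p j) l) (Comp K (f m p j) (arrow n i m j))"
    unfolding arrow_def[of m j p l]
    by (rule Comp_assoc[OF arrow_in_Hom[OF nm] family_in_Hom[OF le(3)]
          sequenceD(2)[OF term_sequence le(4)]])
  also have "Comp K (f m p j) (arrow n i m j) =
      Comp K (bond (x p) (\<phi> m p (\<phi> n m i)) (\<phi> m p j)) (Comp K (f m p (\<phi> n m i)) (f n m i))"
    unfolding arrow_def
    by (rule transformation_comp_bond[OF term_sequence term_sequence term_trans[OF le(3)]
          family_in_Hom[OF le(1)] le(2)])
  also have "\<dots> = Comp K (bond (x p) (\<phi> n p i) (\<phi> m p j)) (f n p i)"
    using le by (simp add: index_comp family_comp)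
  also have "Comp K (bond (x p) (\<phi> m p j) l) \<dots> = arrow n i p l"
    unfolding arrow_def
    by (rule bond_bond_comp[OF term_sequence _ le(4) family_in_Hom])
      (use le index_mono[OF le(3,2)] index_comp[OF le(1,3)] in auto)
  finally show ?thesis .
qed

lemma arrow_same: "i \<le> j \<Longrightarrow> arrow n i n j = bond (x n) i j"
  using term_refl[of n] Comp_Ident_right[OF sequenceD(2)[OF term_sequence]]
  by (simp add: arrow_def trans_ident_def)

lemma arrow_family: "n \<le> m \<Longrightarrow> arrow n i m (\<phi> n m i) = f n m i"
  unfolding arrow_def by (rule bond_refl_comp[OF term_sequence family_in_Hom])

end


section \<open>The diagonal sequence is a colimit\<close>

text \<open>
  The chain condition makes the restriction to the pairs \<open>(n, k n)\<close> a sequence. The cofinality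
  condition is only required at \<open>(n, m)\<close> for \<open>n \<le> m\<close>; by monotonicity every pair \<open>(n, i)\<close> then
  lies below \<open>(m, k m)\<close> for \<open>m = max n i\<close>.
\<close>

locale diagonal = transformation_sequence K x \<phi> f
  for K :: "('o, 'a) precategory" and x \<phi> f +
  fixes k :: "nat \<Rightarrow> nat"
  assumes diagonal_chain: "n \<le> m \<Longrightarrow> below n (k n) m (k m)"
    and diagonal_cofinal: "n \<le> m \<Longrightarrow> below n m m (k m)"
begin

definition diag :: "('o, 'a) seq" where
  "diag = \<lparr>ob = \<lambda>n. ob (x n) (k n),
    bond = \<lambda>n m. if n \<le> m then arrow n (k n) m (k m) else undefined\<rparr>"

text \<open>
  The colimit arrow from the row \<open>x n\<close> sends \<open>(n, i)\<close> to the diagonal pair with number \<open>max n i\<close>,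
  an explicit choice of a bound that is monotone and unbounded in \<open>i\<close>.
\<close>

definition inj_index :: "nat \<Rightarrow> nat \<Rightarrow> nat" where
  "inj_index n i = max n i"

definition inj_family :: "nat \<Rightarrow> nat \<Rightarrow> 'a" where
  "inj_family n i = arrow n i (max n i) (k (max n i))"

lemma ob_diag: "ob diag n = ob (x n) (k n)"
  by (simp add: diag_def)

lemma bond_diag: "n \<le> m \<Longrightarrow> bond diag n m = arrow n (k n) m (k m)"
  by (simp add: diag_def)

lemma below_diag:
  assumes "n \<le> m" "i \<le> m"
  shows "below n i m (k m)"
  using diagonal_cofinal[OF assms(1)] index_mono[OF assms] assms(1) by (simp add: below_def)

lemma is_sequence_diag: "is_sequence K diag"
  unfolding is_sequence_def
proof (intro conjI allI impI)
  show "ob diag n \<in> Obj K" for n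
    by (simp add: ob_diag sequenceD(1)[OF term_sequence])
  show "bond diag n m \<in> Hom K (ob diag n) (ob diag m)" if "n \<le> m" for n m
    using that by (simp add: ob_diag bond_diag arrow_in_Hom diagonal_chain)
  show "bond diag n n = Ident K (ob diag n)" for n
    by (simp add: ob_diag bond_diag arrow_same sequenceD(3)[OF term_sequence])
  show "Comp K (bond diag m l) (bond diag n m) = bond diag n l" if "n \<le> m" "m \<le> l" for n m l
    using that by (simp add: bond_diag arrow_comp diagonal_chain)
  show "bond diag n m = undefined" if "m < n" for n m
    using that by (simp add: diag_def)
qed

lemma inj_in_transformations: "(inj_index n, inj_family n) \<in> transformations K (x n) diag"
  unfolding transformations_def
proof (intro CollectI case_prodI conjI allI impI)
  show "mono (inj_index n)"
    by (rule monoI) (auto simp: inj_index_def)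
  show "filterlim (inj_index n) at_top sequentially"
    by (rule filterlim_at_top_mono[OF filterlim_ident]) (simp add: inj_index_def)
  show "inj_family n i \<in> Hom K (ob (x n) i) (ob diag (inj_index n i))" for i
    by (simp add: inj_family_def inj_index_def ob_diag arrow_in_Hom below_diag)
  show "Comp K (bond diag (inj_index n i) (inj_index n j)) (inj_family n i) =
      Comp K (inj_family n j) (bond (x n) i j)" if "i < j" for i j
  proof -
    have "Comp K (bond diag (max n i) (max n j)) (inj_family n i) =
        arrow n i (max n j) (k (max n j))"
      using that unfolding inj_family_def
      by (subst bond_diag) (auto intro!: arrow_comp below_diag diagonal_chain)
    moreover have "Comp K (inj_family n j) (bond (x n) i j) = arrow n i (max n j) (k (max n j))"
      using that arrow_same[of i j n] arrow_comp[of n i n j "max n j" "k (max n j)"]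
      by (simp add: inj_family_def below_same below_diag)
    ultimately show ?thesis
      by (simp add: inj_index_def)
  qed
qed

lemma germ_eq_arrow:
  assumes p: "below n i p (k p)" and q: "below n i q (k q)"
  shows "germ_eq K diag p (arrow n i p (k p)) q (arrow n i q (k q))"
  unfolding germ_eq_def
  by (intro exI[of _ "max p q"])
    (simp add: bond_diag arrow_comp[OF p diagonal_chain] arrow_comp[OF q diagonal_chain])

lemma inj_cocone:
  assumes "n \<le> m"
  shows "(trans_comp K (inj_index m, inj_family m) (\<phi> n m, f n m), (inj_index n, inj_family n))
    \<in> trans_rel K (x n) diag"
proof -
  have "germ_eq K diag (inj_index m (\<phi> n m i)) (Comp K (inj_family m (\<phi> n m i)) (f n m i))
      (inj_index n i) (inj_family n i)" for i
  proof -
    define p where "p = max m (\<phi> n m i)"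
    have b: "below n i m (\<phi> n m i)" "below m (\<phi> n m i) p (k p)"
      using assms below_diag[of m p "\<phi> n m i"] by (auto simp: below_def p_def)
    have "Comp K (inj_family m (\<phi> n m i)) (f n m i) = arrow n i p (k p)"
      using arrow_comp[OF b] assms by (simp add: inj_family_def arrow_family p_def)
    moreover have "germ_eq K diag p (arrow n i p (k p)) (max n i) (inj_family n i)"
      unfolding inj_family_def
      by (rule germ_eq_arrow[OF below_trans[OF b]]) (simp add: below_diag)
    ultimately show ?thesis
      by (simp add: inj_index_def p_def)
  qed
  then show ?thesis
    using trans_comp_in[OF term_sequence term_sequence is_sequence_diag inj_in_transformations
        term_trans[OF assms]] inj_in_transformations
    by (simp add: trans_comp_Pair trans_rel_iff_germ_eq)
qed

text \<open>
  A cocone on the rows is a cocone, up to germ equality, on the whole functor on pairs: along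
  \<open>f n m\<close> by the cocone property and along \<open>x m\<close> by naturality of its components.
\<close>

lemma germ_eq_cocone_arrow:
  assumes w: "is_sequence K w"
    and h: "\<And>n. (\<eta> n, h n) \<in> transformations K (x n) w"
    and compat: "\<And>n m. n \<le> m \<Longrightarrow>
      (trans_comp K (\<eta> m, h m) (\<phi> n m, f n m), (\<eta> n, h n)) \<in> trans_rel K (x n) w"
    and b: "below n i m j"
  shows "germ_eq K w (\<eta> m j) (Comp K (h m j) (arrow n i m j)) (\<eta> n i) (h n i)"
proof -
  have le: "n \<le> m" "\<phi> n m i \<le> j"
    using b by (auto simp: below_def)
  note hH = transformationsD(3)[OF h] and fH = family_in_Hom[OF le(1)]
    and xH = sequenceD(2)[OF term_sequence le(2)]
  have "Comp K (h m j) (arrow n i m j) = Comp K (Comp K (h m j) (bond (x m) (\<phi> n m i) j)) (f n m i)"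
    unfolding arrow_def using Comp_assoc[OF fH xH hH] by simp
  moreover have "germ_eq K w (\<eta> m (\<phi> n m i)) (Comp K (h m (\<phi> n m i)) (f n m i))
      (\<eta> m j) (Comp K (Comp K (h m j) (bond (x m) (\<phi> n m i) j)) (f n m i))"
    by (rule germ_eq_precomp[OF w fH hH Comp_in_Hom[OF xH hH]
          germ_eq_transformation[OF term_sequence w h le(2)]])
  moreover have "germ_eq K w (\<eta> m (\<phi> n m i)) (Comp K (h m (\<phi> n m i)) (f n m i)) (\<eta> n i) (h n i)"
    using compat[OF le(1)] by (simp add: trans_comp_Pair trans_rel_iff_germ_eq)
  ultimately show ?thesis
    using germ_eq_trans[OF w Comp_in_Hom[OF arrow_in_Hom[OF b] hH] Comp_in_Hom[OF fH hH] hH]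
      germ_eq_sym by metis
qed

text \<open>
  The mediating arrow has the germ of \<open>h n\<close> at \<open>k n\<close> as its \<open>n\<close>-th component.
\<close>

lemma diag_universal:
  assumes w: "is_sequence K w"
    and h: "\<And>n. (\<eta> n, h n) \<in> transformations K (x n) w"
    and compat: "\<And>n m. n \<le> m \<Longrightarrow>
      (trans_comp K (\<eta> m, h m) (\<phi> n m, f n m), (\<eta> n, h n)) \<in> trans_rel K (x n) w"
  obtains u where "u \<in> transformations K diag w"
    "\<And>n. (trans_comp K u (inj_index n, inj_family n), (\<eta> n, h n)) \<in> trans_rel K (x n) w"
proof -
  note hH = transformationsD(3)[OF h]
  have arrow_germ: "germ_eq K w (\<eta> m j) (Comp K (h m j) (arrow n i m j)) (\<eta> n i) (h n i)"
    if "below n i m j" for n i m j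
    by (rule germ_eq_cocone_arrow[OF w h compat that])
  obtain \<alpha> u where u: "(\<alpha>, u) \<in> transformations K diag w"
    and germ_u: "\<And>n. germ_eq K w (\<alpha> n) (u n) (\<eta> n (k n)) (h n (k n))"
  proof (rule transformation_of_germs[OF is_sequence_diag w])
    show "h n (k n) \<in> Hom K (ob diag n) (ob w (\<eta> n (k n)))" for n
      by (simp add: ob_diag hH)
    show "germ_eq K w (\<eta> n (k n)) (h n (k n))
        (\<eta> (Suc n) (k (Suc n))) (Comp K (h (Suc n) (k (Suc n))) (bond diag n (Suc n)))" for n
      by (rule germ_eq_sym) (simp add: bond_diag arrow_germ diagonal_chain)
  qed blast
  have "(trans_comp K (\<alpha>, u) (inj_index n, inj_family n), (\<eta> n, h n)) \<in> trans_rel K (x n) w" for n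
  proof -
    have "germ_eq K w (\<alpha> (inj_index n i)) (Comp K (u (inj_index n i)) (inj_family n i))
        (\<eta> n i) (h n i)" for i
    proof -
      define p where "p = max n i"
      have b: "below n i p (k p)"
        by (simp add: p_def below_diag)
      note aH = arrow_in_Hom[OF b]
      have uH: "u p \<in> Hom K (ob (x p) (k p)) (ob w (\<alpha> p))"
        using transformationsD(3)[OF u, of p] by (simp add: ob_diag)
      have "germ_eq K w (\<alpha> p) (Comp K (u p) (arrow n i p (k p))) (\<eta> n i) (h n i)"
        by (rule germ_eq_trans[OF w Comp_in_Hom[OF aH uH] Comp_in_Hom[OF aH hH] hH
              germ_eq_precomp[OF w aH uH hH germ_u] arrow_germ[OF b]])
      then show ?thesis
        by (simp add: inj_index_def inj_family_def p_def)
    qed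
    then show ?thesis
      using trans_comp_in[OF term_sequence is_sequence_diag w u inj_in_transformations] h
      by (simp add: trans_comp_Pair trans_rel_iff_germ_eq)
  qed
  with u show thesis
    using that by blast
qed

text \<open>
  The \<open>n\<close>-th component of a transformation out of the diagonal is determined, as a germ, by its
  composite with a later bonding arrow, and the bonding arrow from \<open>n\<close> to \<open>max n (k n)\<close> is the
  component at \<open>k n\<close> of the \<open>n\<close>-th colimit arrow.
\<close>

lemma diag_jointly_epi:
  assumes w: "is_sequence K w"
    and u: "u \<in> transformations K diag w" and u': "u' \<in> transformations K diag w"
    and eq: "\<And>n. (trans_comp K u (inj_index n, inj_family n),
      trans_comp K u' (inj_index n, inj_family n)) \<in> trans_rel K (x n) w"
  shows "(u, u') \<in> trans_rel K diag w"
proof -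
  obtain \<alpha> a \<beta> b where eqs: "u = (\<alpha>, a)" "u' = (\<beta>, b)"
    by (metis surj_pair)
  note a = u[unfolded eqs] and b = u'[unfolded eqs]
  have "germ_eq K w (\<alpha> n) (a n) (\<beta> n) (b n)" for n
  proof -
    define p where "p = max n (k n)"
    have np: "n \<le> p"
      by (simp add: p_def)
    have bd: "bond diag n p = inj_family n (k n)"
      by (simp add: bond_diag inj_family_def p_def)
    note bH = sequenceD(2)[OF is_sequence_diag np]
    have "germ_eq K w (\<alpha> p) (Comp K (a p) (bond diag n p)) (\<beta> p) (Comp K (b p) (bond diag n p))"
      using eq[of n] unfolding bd
      by (simp add: eqs trans_comp_Pair trans_rel_iff_germ_eq p_def inj_index_def)
    then show ?thesis
      using germ_eq_transformation[OF is_sequence_diag w a np]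
        germ_eq_transformation[OF is_sequence_diag w b np]
        germ_eq_trans[OF w] germ_eq_sym transformationsD(3)[OF a] transformationsD(3)[OF b]
        Comp_in_Hom[OF bH transformationsD(3)[OF a]] Comp_in_Hom[OF bH transformationsD(3)[OF b]]
      by metis
  qed
  then show ?thesis
    using a b by (simp add: eqs trans_rel_iff_germ_eq)
qed

end


section \<open>Norm estimates along the diagonal\<close>

locale Cauchy_transformation_sequence =
  transformation_sequence K x \<phi> f + normed_category K \<mu>
  for K :: "('o, 'a) precategory" and x \<phi> f and \<mu> :: "'a \<Rightarrow> ennreal" +
  assumes Cauchy_term: "Cauchy_seq K \<mu> (x n)"
    and Cauchy_classes: "\<epsilon> > 0 \<Longrightarrow> \<exists>n\<^sub>0. \<forall>m n. n\<^sub>0 < m \<longrightarrow> m \<le> n \<longrightarrow>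
      sigma_norm \<mu> (sigma_class K (x m) (x n) (\<phi> m n, f m n)) < ennreal \<epsilon>"
begin

text \<open>
  All requirements on \<open>k n\<close> except the chain condition are upward closed and satisfiable for
  each \<open>n\<close> separately, and the chain condition only bounds \<open>k (n + 1)\<close> from below by \<open>k n\<close>, so \<open>k\<close>
  can be chosen recursively.
\<close>

lemma diagonal_indices:
  obtains k where "diagonal K x \<phi> f k"
    "\<And>n i j. k n \<le> i \<Longrightarrow> i \<le> j \<Longrightarrow> \<mu> (bond (x n) i j) < ennreal (inverse (real (Suc n)))"
proof -
  define P where "P n l \<longleftrightarrow> (\<forall>i\<le>n. \<phi> i n n \<le> l) \<and>
    (\<forall>i j. l \<le> i \<longrightarrow> i \<le> j \<longrightarrow> \<mu> (bond (x n) i j) < ennreal (inverse (real (Suc n))))" for n l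
  have ex: "\<exists>l\<ge>l\<^sub>0. P n l" for n l\<^sub>0
  proof -
    have "inverse (real (Suc n)) > 0"
      by simp
    then obtain c where c: "\<And>i j. c < i \<Longrightarrow> i \<le> j \<Longrightarrow>
        \<mu> (bond (x n) i j) < ennreal (inverse (real (Suc n)))"
      using Cauchy_term[of n] unfolding Cauchy_seq_def by blast
    define l where "l = l\<^sub>0 + Suc c + (\<Sum>i\<le>n. \<phi> i n n)"
    have "\<phi> i n n \<le> l" if "i \<le> n" for i
      using that member_le_sum[of i "{..n}" "\<lambda>i. \<phi> i n n"] by (simp add: l_def)
    moreover have "\<mu> (bond (x n) i j) < ennreal (inverse (real (Suc n)))" if "l \<le> i" "i \<le> j" for i j
      using that by (intro c) (auto simp: l_def)
    ultimately have "P n l"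
      by (simp add: P_def)
    moreover have "l\<^sub>0 \<le> l"
      by (simp add: l_def)
    ultimately show ?thesis
      by blast
  qed
  have "\<exists>k. \<forall>n. P n (k n) \<and> \<phi> n (Suc n) (k n) \<le> k (Suc n)"
    by (rule dependent_nat_choice) (use ex in blast)+
  then obtain k where P: "\<And>n. P n (k n)" and step: "\<And>n. \<phi> n (Suc n) (k n) \<le> k (Suc n)"
    by blast
  have chain: "below n (k n) m (k m)" if "n \<le> m" for n m
    using that
  proof (induction m rule: dec_induct)
    case base
    show ?case
      by (simp add: below_same)
  next
    case (step m)
    have "below m (k m) (Suc m) (k (Suc m))"
      using \<open>\<And>n. \<phi> n (Suc n) (k n) \<le> k (Suc n)\<close> by (simp add: below_def)
    with step.IH show ?case
      by (rule below_trans)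
  qed
  show thesis
  proof (rule that)
    show "diagonal K x \<phi> f k"
      by unfold_locales (use chain P in \<open>auto simp: P_def below_def\<close>)
    show "\<mu> (bond (x n) i j) < ennreal (inverse (real (Suc n)))" if "k n \<le> i" "i \<le> j" for n i j
      using P that by (simp add: P_def)
  qed
qed

end

locale Cauchy_diagonal =
  Cauchy_transformation_sequence K x \<phi> f \<mu> + diagonal K x \<phi> f k
  for K :: "('o, 'a) precategory" and x \<phi> f and \<mu> :: "'a \<Rightarrow> ennreal" and k +
  assumes tail: "k n \<le> i \<Longrightarrow> i \<le> j \<Longrightarrow> \<mu> (bond (x n) i j) < ennreal (inverse (real (Suc n)))"
begin

text \<open>
  For \<open>l\<close> large, following the arrow from \<open>(n, i)\<close> to \<open>(m, j)\<close> by a bonding arrow of \<open>x m\<close> gives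
  \<open>f n m l\<close> preceded by a bonding arrow of \<open>x n\<close>. Both bonding arrows lie in the tails, so the norm
  axioms compare the arrow with \<open>f n m l\<close>, whose norm tends to that of the class as \<open>l\<close> grows. The
  intermediate index \<open>\<phi> n m i\<close> may lie before the tail of \<open>x m\<close>, so the norm of \<open>f n m i\<close> itself
  need not satisfy such a bound.
\<close>

lemma norm_arrow_le:
  assumes b: "below n i m j" and i: "k n \<le> i" and j: "k m \<le> j"
  shows "\<mu> (arrow n i m j) \<le> sigma_norm \<mu> (sigma_class K (x n) (x m) (\<phi> n m, f n m)) +
    ennreal (inverse (real (Suc n))) + ennreal (inverse (real (Suc m)))"
    (is "_ \<le> ?\<sigma> + ?en + ?em")
proof -
  have le: "n \<le> m" "\<phi> n m i \<le> j"
    using b by (auto simp: below_def)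
  note T = term_trans[OF le(1)]
  have lim: "(\<lambda>l. \<mu> (f n m l) + ?en + ?em) \<longlonglongrightarrow> ?\<sigma> + ?en + ?em"
    by (intro tendsto_add tendsto_const sigma_norm_class_LIMSEQ[OF Cauchy_term Cauchy_term T])
  have "\<forall>\<^sub>F l in sequentially. j \<le> \<phi> n m l"
    using transformationsD(2)[OF T] by (simp add: filterlim_at_top)
  then have "\<forall>\<^sub>F l in sequentially. \<mu> (arrow n i m j) \<le> \<mu> (f n m l) + ?en + ?em"
    using eventually_ge_at_top[of i]
  proof eventually_elim
    case (elim l)
    note aH = arrow_in_Hom[OF b] and xm = sequenceD(2)[OF term_sequence elim(1)]
      and xn = sequenceD(2)[OF term_sequence elim(2)]
    have b': "below m j m (\<phi> n m l)" "below n i n l" "below n l m (\<phi> n m l)"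
      using elim le by (auto simp: below_same below_def)
    have eq: "Comp K (bond (x m) j (\<phi> n m l)) (arrow n i m j) = Comp K (f n m l) (bond (x n) i l)"
      using arrow_comp[OF b b'(1)] arrow_comp[OF b'(2,3)] elim le
      by (simp add: arrow_same arrow_family)
    have "\<mu> (arrow n i m j) \<le>
        \<mu> (Comp K (bond (x m) j (\<phi> n m l)) (arrow n i m j)) + \<mu> (bond (x m) j (\<phi> n m l))"
      by (rule norm_right_factor[OF aH xm])
    also have "\<dots> \<le> (\<mu> (f n m l) + \<mu> (bond (x n) i l)) + \<mu> (bond (x m) j (\<phi> n m l))"
      unfolding eq by (rule add_right_mono[OF norm_Comp[OF xn family_in_Hom[OF le(1)]]])
    also have "\<dots> \<le> (\<mu> (f n m l) + ?en) + ?em"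
      using tail[OF i elim(2)] tail[OF j elim(1)] by (intro add_mono) auto
    finally show ?case .
  qed
  then show ?thesis
    by (intro tendsto_lowerbound[OF lim]) auto
qed

lemma norm_arrow_small:
  assumes "\<epsilon> > 0"
  obtains N where "\<And>n i m j. N \<le> n \<Longrightarrow> below n i m j \<Longrightarrow> k n \<le> i \<Longrightarrow> k m \<le> j \<Longrightarrow>
    \<mu> (arrow n i m j) < ennreal \<epsilon>"
proof -
  obtain n\<^sub>0 where n0: "\<And>m n. n\<^sub>0 < m \<Longrightarrow> m \<le> n \<Longrightarrow>
      sigma_norm \<mu> (sigma_class K (x m) (x n) (\<phi> m n, f m n)) < ennreal (\<epsilon> / 4)"
    using Cauchy_classes[of "\<epsilon> / 4"] assms by auto
  obtain n\<^sub>1 where n1: "inverse (real (Suc n\<^sub>1)) < \<epsilon> / 4"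
    using reals_Archimedean[of "\<epsilon> / 4"] assms by auto
  have inv: "ennreal (inverse (real (Suc n))) \<le> ennreal (\<epsilon> / 4)" if "n\<^sub>1 \<le> n" for n
  proof (rule ennreal_leI)
    have "inverse (real (Suc n)) \<le> inverse (real (Suc n\<^sub>1))"
      using that by (intro le_imp_inverse_le) auto
    then show "inverse (real (Suc n)) \<le> \<epsilon> / 4"
      using n1 by linarith
  qed
  show thesis
  proof (rule that)
    fix n i m j
    assume n: "Suc (max n\<^sub>0 n\<^sub>1) \<le> n" and b: "below n i m j" and ij: "k n \<le> i" "k m \<le> j"
    have "n \<le> m"
      using b by (simp add: below_def)
    have "\<mu> (arrow n i m j) \<le> ennreal (\<epsilon> / 4) + ennreal (\<epsilon> / 4) + ennreal (\<epsilon> / 4)"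
    proof (rule order_trans[OF norm_arrow_le[OF b ij]], intro add_mono)
      show "sigma_norm \<mu> (sigma_class K (x n) (x m) (\<phi> n m, f n m)) \<le> ennreal (\<epsilon> / 4)"
        using n \<open>n \<le> m\<close> by (intro n0[THEN less_imp_le]) auto
    qed (use n \<open>n \<le> m\<close> in \<open>auto intro!: inv simp del: of_nat_Suc\<close>)
    also have "\<dots> = ennreal (3 * \<epsilon> / 4)"
      using assms by (simp add: ennreal_plus[symmetric] del: ennreal_plus)
    also have "\<dots> < ennreal \<epsilon>"
      using assms by (intro ennreal_lessI) auto
    finally show "\<mu> (arrow n i m j) < ennreal \<epsilon>" .
  qed
qed

lemma Cauchy_diag: "Cauchy_seq K \<mu> diag"
  unfolding Cauchy_seq_def
proof (intro conjI allI impI)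
  show "is_sequence K diag"
    by (rule is_sequence_diag)
  fix \<epsilon> :: real
  assume "\<epsilon> > 0"
  then obtain N where N: "\<And>n i m j. N \<le> n \<Longrightarrow> below n i m j \<Longrightarrow> k n \<le> i \<Longrightarrow> k m \<le> j \<Longrightarrow>
      \<mu> (arrow n i m j) < ennreal \<epsilon>"
    using norm_arrow_small by blast
  show "\<exists>n\<^sub>0. \<forall>m n. n\<^sub>0 < m \<longrightarrow> m \<le> n \<longrightarrow> \<mu> (bond diag m n) < ennreal \<epsilon>"
    by (intro exI[of _ N]) (auto simp: bond_diag intro!: N diagonal_chain)
qed

lemma norm_inj_LIMSEQ:
  "(\<lambda>n. sigma_norm \<mu> (sigma_class K (x n) diag (inj_index n, inj_family n))) \<longlonglongrightarrow> 0"
proof (rule order_tendstoI)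
  fix a :: ennreal
  assume "0 < a"
  then obtain c where c: "0 < c" "c < a"
    using dense by blast
  then obtain \<epsilon> where \<epsilon>: "\<epsilon> > 0" "c = ennreal \<epsilon>"
    by (cases c) (auto simp: less_top[symmetric])
  obtain N where N: "\<And>n i m j. N \<le> n \<Longrightarrow> below n i m j \<Longrightarrow> k n \<le> i \<Longrightarrow> k m \<le> j \<Longrightarrow>
      \<mu> (arrow n i m j) < ennreal \<epsilon>"
    using norm_arrow_small[OF \<epsilon>(1)] by blast
  have "sigma_norm \<mu> (sigma_class K (x n) diag (inj_index n, inj_family n)) \<le> ennreal \<epsilon>"
    if "N \<le> n" for n
  proof (rule LIMSEQ_le_const2[OF sigma_norm_class_LIMSEQ[OF Cauchy_term Cauchy_diag
          inj_in_transformations]])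
    show "\<exists>M. \<forall>i\<ge>M. \<mu> (inj_family n i) \<le> ennreal \<epsilon>"
      using that by (intro exI[of _ "k n"])
        (auto simp: inj_family_def intro!: N[THEN less_imp_le] below_diag)
  qed
  then show "\<forall>\<^sub>F n in sequentially.
      sigma_norm \<mu> (sigma_class K (x n) diag (inj_index n, inj_family n)) < a"
    using c \<epsilon>(2) unfolding eventually_sequentially by (meson le_less_trans)
qed simp

text \<open>
  On classes, composition and equality translate to \<open>trans_comp\<close> and \<open>trans_rel\<close>, so the colimit
  property is what \<open>inj_cocone\<close>, \<open>diag_universal\<close> and \<open>diag_jointly_epi\<close> say about representatives.
\<close>

lemma convergent_to_diag:
  assumes ob: "\<And>n. ob X n = x n"
    and bond: "\<And>n m. n \<le> m \<Longrightarrow> bond X n m = sigma_class K (x n) (x m) (\<phi> n m, f n m)"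
  shows "convergent_seq (sigma_cat K \<mu>) (sigma_norm \<mu>) X"
proof -
  define g where "g n = sigma_class K (x n) diag (inj_index n, inj_family n)" for n
  note seqs = term_sequence is_sequence_diag and inj = inj_in_transformations
  have "is_cocone (sigma_cat K \<mu>) X diag g"
    unfolding is_cocone_def
  proof (intro conjI allI impI)
    show "diag \<in> Obj (sigma_cat K \<mu>)"
      by (simp add: Obj_sigma_cat Cauchy_diag)
    show "g n \<in> Hom (sigma_cat K \<mu>) (ob X n) diag" for n
      unfolding g_def ob by (rule sigma_class_in_Hom[OF Cauchy_term Cauchy_diag inj])
    show "Comp (sigma_cat K \<mu>) (g m) (bond X n m) = g n" if "n < m" for n m
    proof -
      have le: "n \<le> m"
        using that by simp
      show ?thesis
        unfolding g_def bond[OF le] Comp_sigma_class[OF seqs(1,1,2) inj term_trans[OF le]]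
          sigma_class_eq_iff[OF seqs(2) trans_comp_in[OF seqs(1,1,2) inj term_trans[OF le]] inj]
        by (rule inj_cocone[OF le])
    qed
  qed
  moreover have "\<exists>!u. u \<in> Hom (sigma_cat K \<mu>) diag w \<and> (\<forall>n. Comp (sigma_cat K \<mu>) u (g n) = h' n)"
    if cocone: "is_cocone (sigma_cat K \<mu>) X w h'" for w h'
  proof -
    have cw: "Cauchy_seq K \<mu> w"
      using cocone by (simp add: is_cocone_def Obj_sigma_cat)
    note w = Cauchy_seq_is_sequence[OF cw]
    have "h' n \<in> Hom (sigma_cat K \<mu>) (x n) w" for n
      using cocone by (simp add: is_cocone_def ob)
    then have "\<exists>t. \<forall>n. t n \<in> transformations K (x n) w \<and> h' n = sigma_class K (x n) w (t n)"
      unfolding Hom_sigma_cat by (intro choice) blast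
    then obtain t where t: "\<And>n. t n \<in> transformations K (x n) w"
      and h': "\<And>n. h' n = sigma_class K (x n) w (t n)"
      by blast
    have compat: "(trans_comp K (t m) (\<phi> n m, f n m), t n) \<in> trans_rel K (x n) w" if "n \<le> m" for n m
    proof -
      have "Comp (sigma_cat K \<mu>) (h' m) (bond X n m) = h' n"
      proof (cases "n = m")
        case True
        then show ?thesis
          using t[of m] Comp_sigma_class[OF seqs(1,1) w t trans_ident_in[OF seqs(1)]]
          by (simp add: bond h' term_refl trans_comp_ident_right)
      next
        case False
        then show ?thesis
          using cocone that by (simp add: is_cocone_def)
      qed
      then show ?thesis
        unfolding h' bond[OF that] Comp_sigma_class[OF seqs(1,1) w t term_trans[OF that]]
          sigma_class_eq_iff[OF w trans_comp_in[OF seqs(1,1) w t term_trans[OF that]] t] .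
    qed
    obtain u where u: "u \<in> transformations K diag w"
      and ug: "\<And>n. (trans_comp K u (inj_index n, inj_family n), t n) \<in> trans_rel K (x n) w"
      using diag_universal[OF w, of "\<lambda>n. fst (t n)" "\<lambda>n. snd (t n)"] t compat by auto
    have Comp_g: "Comp (sigma_cat K \<mu>) (sigma_class K diag w s) (g n) = h' n \<longleftrightarrow>
        (trans_comp K s (inj_index n, inj_family n), t n) \<in> trans_rel K (x n) w"
      if s: "s \<in> transformations K diag w" for s n
      unfolding g_def h' Comp_sigma_class[OF seqs w s inj]
      by (rule sigma_class_eq_iff[OF w trans_comp_in[OF seqs w s inj] t])
    show ?thesis
    proof (rule ex1I[of _ "sigma_class K diag w u"])
      show "sigma_class K diag w u \<in> Hom (sigma_cat K \<mu>) diag w \<and>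
          (\<forall>n. Comp (sigma_cat K \<mu>) (sigma_class K diag w u) (g n) = h' n)"
        using sigma_class_in_Hom[OF Cauchy_diag cw u] Comp_g[OF u] ug by blast
      fix U
      assume U: "U \<in> Hom (sigma_cat K \<mu>) diag w \<and> (\<forall>n. Comp (sigma_cat K \<mu>) U (g n) = h' n)"
      then obtain s where s: "s \<in> transformations K diag w" "U = sigma_class K diag w s"
        by (auto simp: Hom_sigma_cat)
      have "(trans_comp K s (inj_index n, inj_family n), trans_comp K u (inj_index n, inj_family n))
          \<in> trans_rel K (x n) w" for n
        using U Comp_g[OF s(1)] ug[of n] equiv_trans_rel[OF w, of "x n"] unfolding s(2)
        by (meson equivE symD transD)
      then show "U = sigma_class K diag w u"
        unfolding s(2) sigma_class_eq_iff[OF w s(1) u] by (rule diag_jointly_epi[OF w s(1) u])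
    qed
  qed
  ultimately have "is_colimit (sigma_cat K \<mu>) X diag g"
    by (simp add: is_colimit_def)
  then show ?thesis
    using norm_inj_LIMSEQ unfolding convergent_seq_def g_def by blast
qed

end


section \<open>Strict representatives and completeness\<close>

text \<open>
  Representatives chosen independently for all pairs \<open>n \<le> m\<close> would compose only up to
  \<open>trans_rel\<close>. Choosing them for consecutive terms and composing makes the family strictly
  functorial, since composition of transformations is strictly associative and unital.
\<close>

primrec trans_iterate ::
    "('o, 'a) precategory \<Rightarrow> (nat \<Rightarrow> ('o, 'a) seq) \<Rightarrow> (nat \<Rightarrow> 'a trans) \<Rightarrow> nat \<Rightarrow> nat \<Rightarrow> 'a trans" where
  "trans_iterate K x t n 0 = trans_ident K (x n)"
| "trans_iterate K x t n (Suc d) = trans_comp K (t (n + d)) (trans_iterate K x t n d)"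

context category
begin

lemma trans_iterate_in:
  assumes x: "\<And>n. is_sequence K (x n)"
    and t: "\<And>n. t n \<in> transformations K (x n) (x (Suc n))"
  shows "trans_iterate K x t n d \<in> transformations K (x n) (x (n + d))"
  by (induction d) (use trans_ident_in[OF x] trans_comp_in[OF x x x t] in auto)

lemma trans_iterate_add:
  assumes x: "\<And>n. is_sequence K (x n)"
    and t: "\<And>n. t n \<in> transformations K (x n) (x (Suc n))"
  shows "trans_comp K (trans_iterate K x t (n + d) e) (trans_iterate K x t n d) =
    trans_iterate K x t n (d + e)"
proof (induction e)
  case 0
  show ?case
    using trans_comp_ident_left[OF trans_iterate_in[of x t, OF assms]] by simp
next
  case (Suc e)
  then show ?case
    using trans_comp_assoc[OF trans_iterate_in[of x t, OF assms, of n d]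
        trans_iterate_in[of x t, OF assms, of "n + d" e] t[of "n + d + e"]]
    by (simp add: add.assoc)
qed

lemma sigma_class_trans_iterate:
  assumes X: "is_sequence (sigma_cat K \<mu>) X"
    and t: "\<And>n. t n \<in> transformations K (ob X n) (ob X (Suc n))"
    and bond: "\<And>n. bond X n (Suc n) = sigma_class K (ob X n) (ob X (Suc n)) (t n)"
  shows "sigma_class K (ob X n) (ob X (n + d)) (trans_iterate K (ob X) t n d) = bond X n (n + d)"
proof (induction d)
  case 0
  show ?case
    using X by (simp add: is_sequence_def Ident_sigma_cat)
next
  case (Suc d)
  have "ob X n \<in> Obj (sigma_cat K \<mu>)" for n
    using X by (simp add: is_sequence_def)
  then have x: "is_sequence K (ob X n)" for n
    unfolding Obj_sigma_cat using Cauchy_seq_is_sequence by blast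
  have "bond X n (n + Suc d) = Comp (sigma_cat K \<mu>) (bond X (n + d) (Suc (n + d))) (bond X n (n + d))"
    using X by (simp add: is_sequence_def)
  also have "\<dots> = sigma_class K (ob X n) (ob X (n + Suc d)) (trans_iterate K (ob X) t n (Suc d))"
    using Comp_sigma_class[OF x x x t trans_iterate_in[of "ob X" t, OF x t]]
    by (simp add: bond Suc.IH[symmetric])
  finally show ?case
    by simp
qed

end

context normed_category
begin

lemma Cauchy_complete_sigma: "Cauchy_complete (sigma_cat K \<mu>) (sigma_norm \<mu>)"
  unfolding Cauchy_complete_def
proof (intro allI impI)
  fix X
  assume X: "Cauchy_seq (sigma_cat K \<mu>) (sigma_norm \<mu>) X"
  note sX = Cauchy_seq_is_sequence[OF X]
  have "ob X n \<in> Obj (sigma_cat K \<mu>)" for n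
    using sX by (simp add: is_sequence_def)
  then have cx: "Cauchy_seq K \<mu> (ob X n)" for n
    by (simp add: Obj_sigma_cat)
  note x = Cauchy_seq_is_sequence[OF cx]
  have "bond X n (Suc n) \<in> Hom (sigma_cat K \<mu>) (ob X n) (ob X (Suc n))" for n
    using sX by (simp add: is_sequence_def)
  then have "\<exists>t. \<forall>n. t n \<in> transformations K (ob X n) (ob X (Suc n)) \<and>
      bond X n (Suc n) = sigma_class K (ob X n) (ob X (Suc n)) (t n)"
    unfolding Hom_sigma_cat by (intro choice) blast
  then obtain t where t: "\<And>n. t n \<in> transformations K (ob X n) (ob X (Suc n))"
    and bond_Suc: "\<And>n. bond X n (Suc n) = sigma_class K (ob X n) (ob X (Suc n)) (t n)"
    by blast
  define T where "T n m = trans_iterate K (ob X) t n (m - n)" for n m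
  define \<phi> where "\<phi> n m = fst (T n m)" for n m
  define f where "f n m = snd (T n m)" for n m
  have pair: "(\<phi> n m, f n m) = T n m" for n m
    by (simp add: \<phi>_def f_def)
  have bond: "bond X n m = sigma_class K (ob X n) (ob X m) (T n m)" if "n \<le> m" for n m
    using sigma_class_trans_iterate[OF sX t bond_Suc, of n "m - n"] that by (simp add: T_def)
  interpret Cauchy_transformation_sequence K "ob X" \<phi> f \<mu>
  proof
    show "is_sequence K (ob X n)" for n
      by (rule x)
    show "(\<phi> n m, f n m) \<in> transformations K (ob X n) (ob X m)" if "n \<le> m" for n m
      using trans_iterate_in[of "ob X" t, OF x t, of n "m - n"] that by (simp add: pair T_def)
    show "(\<phi> n n, f n n) = trans_ident K (ob X n)" for n
      by (simp add: pair T_def)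
    show "trans_comp K (\<phi> m p, f m p) (\<phi> n m, f n m) = (\<phi> n p, f n p)"
      if "n \<le> m" "m \<le> p" for n m p
      using trans_iterate_add[of "ob X" t, OF x t, of n "m - n" "p - m"] that by (simp add: pair T_def)
    show "Cauchy_seq K \<mu> (ob X n)" for n
      by (rule cx)
    show "\<exists>n\<^sub>0. \<forall>m n. n\<^sub>0 < m \<longrightarrow> m \<le> n \<longrightarrow>
        sigma_norm \<mu> (sigma_class K (ob X m) (ob X n) (\<phi> m n, f m n)) < ennreal \<epsilon>"
      if "\<epsilon> > 0" for \<epsilon>
      using X that bond by (auto simp: Cauchy_seq_def pair)
  qed
  obtain k where diagonal: "diagonal K (ob X) \<phi> f k"
    and tail: "\<And>n i j. k n \<le> i \<Longrightarrow> i \<le> j \<Longrightarrow>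
      \<mu> (bond (ob X n) i j) < ennreal (inverse (real (Suc n)))"
    using diagonal_indices by blast
  interpret diagonal K "ob X" \<phi> f k
    by (rule diagonal)
  interpret Cauchy_diagonal K "ob X" \<phi> f \<mu> k
    by unfold_locales (rule tail)
  show "convergent_seq (sigma_cat K \<mu>) (sigma_norm \<mu>) X"
    by (rule convergent_to_diag) (simp_all add: bond pair)
qed

end

theorem theorem3p8:
  fixes K :: "('o, 'a) precategory" and \<mu> :: "'a \<Rightarrow> ennreal"
  assumes "normed_category K \<mu>"
  shows "normed_category (sigma_cat K \<mu>) (sigma_norm \<mu>) \<and>
    Cauchy_complete (sigma_cat K \<mu>) (sigma_norm \<mu>)"
  using normed_category.normed_category_sigma[OF assms]
    normed_category.Cauchy_complete_sigma[OF assms] by blast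

end
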